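(* Let $k$ be a field, $Q$ a finite acyclic quiver, $a$ a sink of $Q$, $\underline{\mathbf d}=(\underline d^0,\dots,\underline d^\nu)$ a filtration and $M$ a $k$-representation of $Q$ of dimension vector $\underline d^\nu$ with $\dim_k\operatorname{Hom}(M,S_a)=s$. Then $\mathrm{Fl}_Q(\underline{\mathbf d},M)$ is empty if and only if $\mathrm{Fl}_{\sigma_aQ}(S_a^+\underline{\mathbf d},S_a^+M)$ is. Moreover, if $k=\mathbb F_q$ is a finite field, then $$\#\mathrm{Fl}_Q(\underline{\mathbf d},M)\equiv\#\mathrm{Fl}_{\sigma_aQ}(S_a^+\underline{\mathbf d},S_a^+M)\mod q.$$
   Context: Representations are finite-dimensional over $k$; varieties are identified with their sets of $k$-points. A filtration is a sequence of dimension vectors $(\underline d^0,\dots,\underline d^\nu)$ with $\underline d^0=0$ and $\underline d^l\le\underline d^{l+1}$; it is a filtration of $M$ if $\underline d^\nu=\underline{\dim}M$. $\mathrm{Fl}_Q(\underline{\mathbf d},M)$ is the set of flags $(U^0\subset\dots\subset U^\nu=M)$ of subrepresentations with $\underline{\dim}\,U^l=\underline d^l$; it is empty if $\underline{\mathbf d}$ is not a filtration of $M$. Given a representation $M$, since $\underline d^0=0$ and $\underline d^\nu=\underline{\dim}M$ are forced, a sequence $(\underline d^0,\dots,\underline d^\nu)$ is identified with $(\underline d^1,\dots,\underline d^{\nu-1})$. With $\langle\underline d,\underline e\rangle=\sum_i d_ie_i-\sum_{\alpha:i\to j}d_ie_j$ and $(\underline d,\underline e)=\langle\underline d,\underline e\rangle+\langle\underline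 e,\underline d\rangle$, put $\sigma_a\underline d=\underline d-(\underline d,\epsilon_a)\epsilon_a$, where $\epsilon_a$ is the unit vector at $a$. $S_a$ is the simple representation at $a$. $\sigma_aQ$ is $Q$ with all arrows at $a$ reversed, $\alpha$ becoming $\alpha^*$. For a sink $a$, $\phi_a^M:\bigoplus_{\alpha:j\to a}M_j\to M_a$ has components $M_\alpha$. $S_a^+M$ is the representation of $\sigma_aQ$ with $(S_a^+M)_i=M_i$ for $i\neq a$, $(S_a^+M)_a=\ker\phi_a^M$, maps $(S_a^+M)_{\alpha^*}$ given by inclusion followed by projection to the summand of $\alpha$, and all other maps unchanged. Reflection of filtrations: define $r_+^0:=0$ and $r_+^l:=\max\{0,(\sigma_a(\underline d^{l-1}-\underline d^l))_a+r_+^{l-1}\}$ for $0<l<\nu$. Then $$S_a^+\underline{\mathbf d}:=(\sigma_a\underline d^1+r_+^1\epsilon_a,\dots,\sigma_a\underline d^{\nu-1}+r_+^{\nu-1}\epsilon_a),$$ completed by $0$ at the beginning and $\underline{\dim}S_a^+M$ at the end. *)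

theory Defs
  imports
    "Graph_Theory.Arc_Walk"
    "HOL-Library.FuncSet"
    "HOL-Library.Function_Algebras"
    "HOL-Library.Product_Plus"
    "HOL-Number_Theory.Cong"
begin

section \<open>Quivers\<close>

text \<open>A quiver is a \<^typ>\<open>('i, 'e) pre_digraph\<close>, which allows multiple arcs and loops; loops
  count as cycles in \<^const>\<open>pre_digraph.cycle\<close>.\<close>

definition finite_acyclic_quiver :: "('i, 'e) pre_digraph \<Rightarrow> bool" where
  "finite_acyclic_quiver Q \<longleftrightarrow> fin_digraph Q \<and> (\<nexists>p. pre_digraph.cycle Q p)"

definition sink :: "('i, 'e) pre_digraph \<Rightarrow> 'i \<Rightarrow> bool" where
  "sink Q a \<longleftrightarrow> a \<in> verts Q \<and> out_arcs Q a = {}"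

text \<open>The reversed arrow of \<open>\<alpha>\<close> keeps the name \<open>\<alpha>\<close>.\<close>

definition reflect_quiver :: "('i, 'e) pre_digraph \<Rightarrow> 'i \<Rightarrow> ('i, 'e) pre_digraph" where
  "reflect_quiver Q a =
     \<lparr> verts = verts Q,
       arcs = arcs Q,
       tail = (\<lambda>e. if tail Q e = a \<or> head Q e = a then head Q e else tail Q e),
       head = (\<lambda>e. if tail Q e = a \<or> head Q e = a then tail Q e else head Q e) \<rparr>"

section \<open>Dimension vectors and filtrations\<close>

text \<open>Dimension vectors are integer-valued, because the reflection of a dimension vector can have
  a negative entry. Only the entries at vertices of the quiver are relevant. A sequence
  \<open>(d\<^sup>0, \<dots>, d\<^sup>\<nu>)\<close> is given by \<open>\<nu>\<close> and a function on \<^typ>\<open>nat\<close> of which only the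
  values at \<open>0, \<dots>, \<nu>\<close> matter.\<close>

definition euler_form :: "('i, 'e) pre_digraph \<Rightarrow> ('i \<Rightarrow> int) \<Rightarrow> ('i \<Rightarrow> int) \<Rightarrow> int" where
  "euler_form Q d e =
     (\<Sum>i\<in>verts Q. d i * e i) - (\<Sum>\<alpha>\<in>arcs Q. d (tail Q \<alpha>) * e (head Q \<alpha>))"

definition sym_euler_form :: "('i, 'e) pre_digraph \<Rightarrow> ('i \<Rightarrow> int) \<Rightarrow> ('i \<Rightarrow> int) \<Rightarrow> int" where
  "sym_euler_form Q d e = euler_form Q d e + euler_form Q e d"

definition unit_dim :: "'i \<Rightarrow> 'i \<Rightarrow> int" where
  "unit_dim a i = (if i = a then 1 else 0)"

definition reflect_dim :: "('i, 'e) pre_digraph \<Rightarrow> 'i \<Rightarrow> ('i \<Rightarrow> int) \<Rightarrow> 'i \<Rightarrow> int" where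
  "reflect_dim Q a d = (\<lambda>i. d i - sym_euler_form Q d (unit_dim a) * unit_dim a i)"

text \<open>The two conditions make all \<open>d\<^sup>l\<close> with \<open>l \<le> \<nu>\<close> nonnegative on vertices.\<close>

definition filtration :: "('i, 'e) pre_digraph \<Rightarrow> nat \<Rightarrow> (nat \<Rightarrow> 'i \<Rightarrow> int) \<Rightarrow> bool" where
  "filtration Q \<nu> d \<longleftrightarrow>
     (\<forall>i\<in>verts Q. d 0 i = 0) \<and> (\<forall>l<\<nu>. \<forall>i\<in>verts Q. d l i \<le> d (Suc l) i)"

primrec r_plus :: "('i, 'e) pre_digraph \<Rightarrow> 'i \<Rightarrow> (nat \<Rightarrow> 'i \<Rightarrow> int) \<Rightarrow> nat \<Rightarrow> int" where
  "r_plus Q a d 0 = 0"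
| "r_plus Q a d (Suc l) = max 0 (reflect_dim Q a (d l - d (Suc l)) a + r_plus Q a d l)"

section \<open>Representations\<close>

text \<open>The vector spaces \<open>vsp M i\<close> are subspaces of a common ambient vector space, of arbitrary
  dimension, with underlying type \<open>'v\<close> and scalar multiplication \<open>scl M\<close>. The map \<open>vmap M \<alpha>\<close>
  is relevant only on \<open>vsp M (tail Q \<alpha>)\<close>.\<close>

record ('i, 'e, 'k, 'v) quiver_rep =
  scl :: "'k \<Rightarrow> 'v \<Rightarrow> 'v"
  vsp :: "'i \<Rightarrow> 'v set"
  vmap :: "'e \<Rightarrow> 'v \<Rightarrow> 'v"

definition linear_on ::
    "('k::field \<Rightarrow> 'v::ab_group_add \<Rightarrow> 'v) \<Rightarrow> ('k \<Rightarrow> 'w::ab_group_add \<Rightarrow> 'w) \<Rightarrow>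
     'v set \<Rightarrow> 'w set \<Rightarrow> ('v \<Rightarrow> 'w) \<Rightarrow> bool" where
  "linear_on s t V W f \<longleftrightarrow>
     f \<in> V \<rightarrow> W \<and> (\<forall>x\<in>V. \<forall>y\<in>V. f (x + y) = f x + f y) \<and> (\<forall>c. \<forall>x\<in>V. f (s c x) = t c (f x))"

definition quiver_representation ::
    "('i, 'e) pre_digraph \<Rightarrow> ('i, 'e, 'k::field, 'v::ab_group_add) quiver_rep \<Rightarrow> bool" where
  "quiver_representation Q M \<longleftrightarrow>
     vector_space (scl M) \<and>
     (\<forall>i\<in>verts Q. module.subspace (scl M) (vsp M i) \<and>
        (\<exists>B. finite B \<and> module.span (scl M) B = vsp M i)) \<and>
     (\<forall>\<alpha>\<in>arcs Q. linear_on (scl M) (scl M) (vsp M (tail Q \<alpha>)) (vsp M (head Q \<alpha>)) (vmap M \<alpha>))"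

definition dim_vector :: "('i, 'e, 'k::field, 'v::ab_group_add) quiver_rep \<Rightarrow> 'i \<Rightarrow> int" where
  "dim_vector M i = int (vector_space.dim (scl M) (vsp M i))"

definition simple_rep :: "'i \<Rightarrow> ('i, 'e, 'k::field, 'k) quiver_rep" where
  "simple_rep a = \<lparr> scl = (*), vsp = (\<lambda>i. if i = a then UNIV else {0}), vmap = (\<lambda>_ _. 0) \<rparr>"

text \<open>A homomorphism is a family of linear maps \<open>vsp M i \<rightarrow> vsp N i\<close>. Extending every component
  by zero outside \<open>vsp M i\<close> makes the family unique as a HOL function, and makes the set of
  homomorphisms a subspace of the function space with pointwise operations.\<close>

definition rep_hom ::
    "('i, 'e) pre_digraph \<Rightarrow> ('i, 'e, 'k::field, 'v::ab_group_add) quiver_rep \<Rightarrow>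
     ('i, 'e, 'k, 'w::ab_group_add) quiver_rep \<Rightarrow> ('i \<Rightarrow> 'v \<Rightarrow> 'w) set" where
  "rep_hom Q M N =
     {h. (\<forall>i\<in>verts Q. linear_on (scl M) (scl N) (vsp M i) (vsp N i) (h i)) \<and>
         (\<forall>\<alpha>\<in>arcs Q. \<forall>x\<in>vsp M (tail Q \<alpha>).
            h (head Q \<alpha>) (vmap M \<alpha> x) = vmap N \<alpha> (h (tail Q \<alpha>) x)) \<and>
         (\<forall>i x. \<not> (i \<in> verts Q \<and> x \<in> vsp M i) \<longrightarrow> h i x = 0)}"

definition hom_dim ::
    "('i, 'e) pre_digraph \<Rightarrow> ('i, 'e, 'k::field, 'v::ab_group_add) quiver_rep \<Rightarrow>
     ('i, 'e, 'k, 'w::ab_group_add) quiver_rep \<Rightarrow> nat" where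
  "hom_dim Q M N = vector_space.dim (\<lambda>c h i x. scl N c (h i x)) (rep_hom Q M N)"

section \<open>Quiver flags\<close>

definition subrep ::
    "('i, 'e) pre_digraph \<Rightarrow> ('i, 'e, 'k::field, 'v::ab_group_add) quiver_rep \<Rightarrow>
     ('i \<Rightarrow> 'v set) \<Rightarrow> bool" where
  "subrep Q M U \<longleftrightarrow>
     (\<forall>i\<in>verts Q. module.subspace (scl M) (U i) \<and> U i \<subseteq> vsp M i) \<and>
     (\<forall>\<alpha>\<in>arcs Q. vmap M \<alpha> ` U (tail Q \<alpha>) \<subseteq> U (head Q \<alpha>))"

text \<open>The flags are extensional functions of \<open>l \<in> {0, \<dots>, \<nu>}\<close> and of the vertex, so that
  different elements of the set are different flags.\<close>

definition Fl ::
    "('i, 'e) pre_digraph \<Rightarrow> nat \<Rightarrow> (nat \<Rightarrow> 'i \<Rightarrow> int) \<Rightarrow>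
     ('i, 'e, 'k::field, 'v::ab_group_add) quiver_rep \<Rightarrow> (nat \<Rightarrow> 'i \<Rightarrow> 'v set) set" where
  "Fl Q \<nu> d M =
     {U \<in> {..\<nu>} \<rightarrow>\<^sub>E (verts Q \<rightarrow>\<^sub>E UNIV).
        (\<forall>l\<le>\<nu>. subrep Q M (U l)) \<and>
        (\<forall>l<\<nu>. \<forall>i\<in>verts Q. U l i \<subseteq> U (Suc l) i) \<and>
        (\<forall>i\<in>verts Q. U \<nu> i = vsp M i) \<and>
        (\<forall>l\<le>\<nu>. \<forall>i\<in>verts Q. int (vector_space.dim (scl M) (U l i)) = d l i)}"

section \<open>The reflection functor at a sink\<close>

text \<open>The direct sum of the \<open>M\<^sub>j\<close> over the arrows \<open>\<alpha> : j \<rightarrow> a\<close>, as functions on arrows which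
  vanish at all other arrows.\<close>

definition incoming_sum ::
    "('i, 'e) pre_digraph \<Rightarrow> 'i \<Rightarrow> ('i, 'e, 'k::field, 'v::ab_group_add) quiver_rep \<Rightarrow>
     ('e \<Rightarrow> 'v) set" where
  "incoming_sum Q a M =
     {f. (\<forall>\<alpha>\<in>in_arcs Q a. f \<alpha> \<in> vsp M (tail Q \<alpha>)) \<and> (\<forall>\<alpha>. \<alpha> \<notin> in_arcs Q a \<longrightarrow> f \<alpha> = 0)}"

definition phi ::
    "('i, 'e) pre_digraph \<Rightarrow> 'i \<Rightarrow> ('i, 'e, 'k::field, 'v::ab_group_add) quiver_rep \<Rightarrow>
     ('e \<Rightarrow> 'v) \<Rightarrow> 'v" where
  "phi Q a M f = (\<Sum>\<alpha>\<in>in_arcs Q a. vmap M \<alpha> (f \<alpha>))"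

text \<open>The ambient space of the reflected representation is the product of that of \<open>M\<close>, which
  contains \<open>M\<^sub>i\<close> for \<open>i \<noteq> a\<close>, and of the functions from arrows to it, which contain the
  direct sum above and so the kernel of \<open>phi\<close>.\<close>

definition reflect_rep ::
    "('i, 'e) pre_digraph \<Rightarrow> 'i \<Rightarrow> ('i, 'e, 'k::field, 'v::ab_group_add) quiver_rep \<Rightarrow>
     ('i, 'e, 'k, 'v \<times> ('e \<Rightarrow> 'v)) quiver_rep" where
  "reflect_rep Q a M =
     \<lparr> scl = (\<lambda>c (x, f). (scl M c x, \<lambda>\<alpha>. scl M c (f \<alpha>))),
       vsp = (\<lambda>i. if i = a then {0} \<times> {f \<in> incoming_sum Q a M. phi Q a M f = 0}
                  else vsp M i \<times> {0}),
       vmap = (\<lambda>\<alpha> (x, f). if \<alpha> \<in> in_arcs Q a then (f \<alpha>, 0) else (vmap M \<alpha> x, 0)) \<rparr>"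

definition reflect_filtration ::
    "('i, 'e) pre_digraph \<Rightarrow> 'i \<Rightarrow> ('i, 'e, 'k::field, 'v::ab_group_add) quiver_rep \<Rightarrow>
     nat \<Rightarrow> (nat \<Rightarrow> 'i \<Rightarrow> int) \<Rightarrow> nat \<Rightarrow> 'i \<Rightarrow> int" where
  "reflect_filtration Q a M \<nu> d l =
     (if l = 0 then (\<lambda>i. 0)
      else if l < \<nu> then (\<lambda>i. reflect_dim Q a (d l) i + r_plus Q a d l * unit_dim a i)
      else dim_vector (reflect_rep Q a M))"

end

theory Submission
  imports Defs "HOL-Library.Cardinality"
begin

text \<open>
  A flag of subrepresentations consists of its components at the vertices \<open>i \<noteq> a\<close> and of the chain of
  its components at \<open>a\<close>. Off \<open>a\<close>, flags of \<open>M\<close> and flags of \<open>S\<^sub>a\<^sup>+ M\<close> are the same data, so both sets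
  of flags fibre over one common base and it suffices to compare the fibres.

  Fix a point of the base and let \<open>X\<^sub>l\<close> be the direct sum of its \<open>l\<close>-th components over the arrows into
  \<open>a\<close>. For \<open>M\<close> the fibre consists of the chains \<open>A\<^sub>0 \<subseteq> \<dots> \<subseteq> A\<^sub>\<nu>\<close> with \<open>\<phi>(X\<^sub>l) \<subseteq> A\<^sub>l \<subseteq> M\<^sub>a\<close> and
  \<open>dim A\<^sub>l = d\<^sub>l\<close>. For \<open>S\<^sub>a\<^sup>+ M\<close> it consists of the chains with \<open>A\<^sub>l \<subseteq> X\<^sub>l \<inter> ker \<phi>\<close> and \<open>dim A\<^sub>l = e\<^sub>l\<close>,
  where \<open>d\<^sub>l\<close> and \<open>e\<^sub>l\<close> denote the entries of the two filtrations at \<open>a\<close>. The members of the first kind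
  of chain can be chosen from the top downwards and those of the second kind from the bottom upwards,
  and then every step chooses a subspace of prescribed dimension between two given ones. Over a
  field with \<open>q\<close> elements the number of choices is a Gaussian binomial coefficient, hence congruent
  to 1 modulo \<open>q\<close> whenever a choice exists at all (\<open>one_modulo_subspaces_between\<close>). So each fibre is
  empty or has cardinality 1 modulo \<open>q\<close>.

  It remains to see that the two fibres are empty simultaneously (\<open>dim_bounds_equiv\<close>). The first one is
  nonempty iff \<open>dim \<phi>(X\<^sub>l) \<le> d\<^sub>l\<close> for all \<open>l\<close>, the second one iff \<open>e\<^sub>l \<le> dim (X\<^sub>l \<inter> ker \<phi>)\<close> for all \<open>l\<close>.
  At \<open>l = \<nu>\<close> both conditions hold, because \<open>d\<^sub>\<nu> = dim M\<^sub>a\<close> and \<open>e\<^sub>\<nu> = dim (X\<^sub>\<nu> \<inter> ker \<phi>)\<close>. For \<open>l < \<nu>\<close>,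
  unfolding the recursion for \<open>r\<^sub>+\<close> shows that \<open>e\<^sub>l\<close> is the maximum of the numbers \<open>dim X\<^sub>j - d\<^sub>j\<close> with
  \<open>j \<le> l\<close>. Since \<open>dim (X\<^sub>l \<inter> ker \<phi>)\<close> increases with \<open>l\<close>, the second condition says
  \<open>dim X\<^sub>l - d\<^sub>l \<le> dim (X\<^sub>l \<inter> ker \<phi>)\<close> for all \<open>l < \<nu>\<close>, and by rank and nullity this is the first condition.
\<close>

section \<open>Cardinalities congruent to one\<close>

text \<open>Nonemptiness is part of the notion, and \<open>q = 0\<close> stands for an infinite field, where only
  nonemptiness remains. Thus one induction proves both the existence and the counting statement.\<close>

definition one_modulo :: "nat \<Rightarrow> 'a set \<Rightarrow> bool" where
  "one_modulo q X \<longleftrightarrow> X \<noteq> {} \<and> (q > 0 \<longrightarrow> finite X \<and> [card X = 1] (mod q))"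

lemma one_modulo_bij:
  assumes "bij_betw f X Y" "one_modulo q X"
  shows "one_modulo q Y"
  using assms bij_betw_finite[of f X Y] bij_betw_same_card[of f X Y]
  by (auto simp: one_modulo_def bij_betw_def)

lemma one_modulo_Sigma:
  assumes "one_modulo q X" "\<And>x. x \<in> X \<Longrightarrow> one_modulo q (Y x)"
  shows "one_modulo q (Sigma X Y)"
proof -
  have "[card (Sigma X Y) = 1] (mod q)" if "q > 0"
  proof -
    have "[(\<Sum>x\<in>X. card (Y x)) = (\<Sum>x\<in>X. 1)] (mod q)"
      using assms that by (intro cong_sum) (auto simp: one_modulo_def)
    moreover have "card (Sigma X Y) = (\<Sum>x\<in>X. card (Y x))"
      using assms that by (intro card_SigmaI) (auto simp: one_modulo_def)
    ultimately show ?thesis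
      using assms that by (auto simp: one_modulo_def intro: cong_trans)
  qed
  then show ?thesis
    using assms by (fastforce simp: one_modulo_def)
qed

text \<open>Two sets fibred over \<open>X\<close> are compared fibre by fibre, whatever the cardinality of \<open>X\<close> is.\<close>

lemma cong_card_Sigma:
  assumes "\<And>x. x \<in> X \<Longrightarrow> Y x = {} \<and> Z x = {} \<or> one_modulo q (Y x) \<and> one_modulo q (Z x)"
  shows "Sigma X Y = {} \<longleftrightarrow> Sigma X Z = {}"
    and "q > 0 \<Longrightarrow> finite X \<Longrightarrow> [card (Sigma X Y) = card (Sigma X Z)] (mod q)"
proof -
  have "Y x = {} \<longleftrightarrow> Z x = {}" if "x \<in> X" for x
    using assms[OF that] by (auto simp: one_modulo_def)
  then show "Sigma X Y = {} \<longleftrightarrow> Sigma X Z = {}" by (auto simp: Sigma_empty_iff)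
  assume q: "q > 0" and X: "finite X"
  have fin: "finite (Y x)" "finite (Z x)" "[card (Y x) = card (Z x)] (mod q)" if "x \<in> X" for x
    using assms[OF that] q by (auto simp: one_modulo_def intro: cong_trans cong_sym)
  have "[(\<Sum>x\<in>X. card (Y x)) = (\<Sum>x\<in>X. card (Z x))] (mod q)"
    using fin(3) by (rule cong_sum)
  then show "[card (Sigma X Y) = card (Sigma X Z)] (mod q)"
    using fin X by simp
qed

text \<open>The relation is a parameter so that a chain read backwards is again a chain.\<close>

definition chains :: "('b \<Rightarrow> 'b \<Rightarrow> bool) \<Rightarrow> nat \<Rightarrow> (nat \<Rightarrow> 'b set) \<Rightarrow> (nat \<Rightarrow> 'b) set" where
  "chains R n T = {A \<in> Pi\<^sub>E {..n} T. \<forall>l<n. R (A l) (A (Suc l))}"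

lemma chains_iff:
  "A \<in> chains R n T \<longleftrightarrow>
     (\<forall>l\<le>n. A l \<in> T l) \<and> (\<forall>l>n. A l = undefined) \<and> (\<forall>l<n. R (A l) (A (Suc l)))"
  by (auto simp: chains_def PiE_iff extensional_def)

lemma chains_subset_PiE: "chains R n T \<subseteq> {..n} \<rightarrow>\<^sub>E UNIV"
proof -
  have "chains R n T \<subseteq> Pi\<^sub>E {..n} T" by (auto simp: chains_def)
  also have "\<dots> \<subseteq> {..n} \<rightarrow>\<^sub>E UNIV" by (rule PiE_mono) simp
  finally show ?thesis .
qed

lemma one_modulo_chains_up:
  assumes "one_modulo q (T 0)"
    and "\<And>l x. l < n \<Longrightarrow> x \<in> T l \<Longrightarrow> one_modulo q {y \<in> T (Suc l). R x y}"
  shows "one_modulo q (chains R n T)"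
  using assms
proof (induction n)
  case 0
  have "bij_betw (\<lambda>x l. if l = 0 then x else undefined) (T 0) (chains R 0 T)"
    by (rule bij_betw_byWitness[where f' = "\<lambda>A. A 0"]) (auto simp: chains_iff fun_eq_iff)
  then show ?case using 0(1) by (rule one_modulo_bij)
next
  case (Suc n)
  let ?S = "Sigma (chains R n T) (\<lambda>A. {y \<in> T (Suc n). R (A n) y})"
  have "one_modulo q ?S"
  proof (rule one_modulo_Sigma)
    show "one_modulo q (chains R n T)" using Suc.prems by (intro Suc.IH) auto
    show "one_modulo q {y \<in> T (Suc n). R (A n) y}" if "A \<in> chains R n T" for A
      using that by (intro Suc.prems) (auto simp: chains_iff)
  qed
  moreover have "bij_betw (\<lambda>(A, y). A(Suc n := y)) ?S (chains R (Suc n) T)"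
  proof (rule bij_betw_byWitness[where f' = "\<lambda>A. (A(Suc n := undefined), A (Suc n))"])
    show "\<forall>p\<in>?S. (\<lambda>A. (A(Suc n := undefined), A (Suc n))) ((\<lambda>(A, y). A(Suc n := y)) p) = p"
      by (auto simp: chains_iff fun_upd_idem)
    show "\<forall>A\<in>chains R (Suc n) T. (\<lambda>(A, y). A(Suc n := y)) (A(Suc n := undefined), A (Suc n)) = A"
      by simp
    show "(\<lambda>(A, y). A(Suc n := y)) ` ?S \<subseteq> chains R (Suc n) T"
      by (auto simp: chains_iff le_Suc_eq less_Suc_eq)
    show "(\<lambda>A. (A(Suc n := undefined), A (Suc n))) ` chains R (Suc n) T \<subseteq> ?S"
      by (auto simp: chains_iff)
  qed
  ultimately show ?case by (rule one_modulo_bij[rotated])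
qed

text \<open>This is the previous lemma for the chains read backwards.\<close>

lemma one_modulo_chains_down:
  assumes "one_modulo q (T n)"
    and "\<And>l y. l < n \<Longrightarrow> y \<in> T (Suc l) \<Longrightarrow> one_modulo q {x \<in> T l. R x y}"
  shows "one_modulo q (chains R n T)"
proof -
  let ?C = "chains R\<inverse>\<inverse> n (\<lambda>l. T (n - l))"
  let ?rev = "\<lambda>A l. if l \<le> n then A (n - l) else undefined"
  have Suc_diff: "Suc (n - Suc l) = n - l" if "l < n" for l using that by simp
  have "one_modulo q ?C"
  proof (rule one_modulo_chains_up)
    show "one_modulo q (T (n - 0))" using assms(1) by simp
    show "one_modulo q {y \<in> T (n - Suc l). R\<inverse>\<inverse> x y}" if "l < n" "x \<in> T (n - l)" for l x
      using assms(2)[of "n - Suc l" x] that Suc_diff[OF that(1)] by simp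
  qed
  moreover have "bij_betw ?rev ?C (chains R n T)"
  proof (rule bij_betw_byWitness[where f' = ?rev])
    show "\<forall>A\<in>?C. ?rev (?rev A) = A" by (auto simp: chains_iff fun_eq_iff)
    show "\<forall>A\<in>chains R n T. ?rev (?rev A) = A" by (auto simp: chains_iff fun_eq_iff)
    show "?rev ` ?C \<subseteq> chains R n T"
    proof (rule image_subsetI)
      fix A assume A: "A \<in> ?C"
      have "A (n - l) \<in> T l" if "l \<le> n" for l
        using A that unfolding chains_iff by (metis diff_diff_cancel diff_le_self)
      moreover have "R (A (n - l)) (A (n - Suc l))" if "l < n" for l
        using A that Suc_diff[OF that] by (auto simp: chains_iff dest!: spec[of _ "n - Suc l"])
      ultimately show "?rev A \<in> chains R n T" by (simp add: chains_iff)
    qed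
    show "?rev ` chains R n T \<subseteq> ?C"
    proof (rule image_subsetI)
      fix A assume A: "A \<in> chains R n T"
      have "R (A (n - Suc l)) (A (n - l))" if "l < n" for l
        using A that Suc_diff[OF that] by (auto simp: chains_iff dest!: spec[of _ "n - Suc l"])
      then show "?rev A \<in> ?C" using A by (simp add: chains_iff)
    qed
  qed
  ultimately show ?thesis by (rule one_modulo_bij[rotated])
qed

section \<open>Subspaces between two given subspaces\<close>

text \<open>The locale \<^locale>\<open>vector_space\<close> is not extended itself, because it is interpreted globally for
  real vector spaces and every new name would then also denote its real instance. The ambient space
  may be infinite-dimensional, so finiteness is a property of single subspaces here.\<close>

locale subspace_counting = vector_space scale
  for scale :: "'a::field \<Rightarrow> 'b::ab_group_add \<Rightarrow> 'b" (infixr \<open>*s\<close> 75)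
begin

definition fin_dim :: "'b set \<Rightarrow> bool" where
  "fin_dim S \<longleftrightarrow> (\<exists>B. finite B \<and> span B = S)"

lemma fin_dim_subspace: "fin_dim S \<Longrightarrow> subspace S"
  by (auto simp: fin_dim_def)

lemma fin_dim_subset:
  assumes "fin_dim Y" "subspace A" "A \<subseteq> Y"
  shows "fin_dim A"
proof -
  obtain B where B: "finite B" "span B = Y" using assms(1) by (auto simp: fin_dim_def)
  obtain C where C: "C \<subseteq> A" "independent C" "A \<subseteq> span C"
    using basis_exists by metis
  have "finite C" using independent_span_bound[OF B(1) C(2)] B(2) C(1) assms(3) by auto
  then show ?thesis
    using span_subspace[OF C(1,3) assms(2)] by (auto simp: fin_dim_def)
qed

lemma fin_dim_basis:
  assumes "fin_dim S"
  obtains B where "finite B" "independent B" "span B = S" "card B = dim S"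
proof -
  obtain B where B: "finite B" "span B = S" using assms by (auto simp: fin_dim_def)
  obtain C where C: "C \<subseteq> S" "independent C" "S \<subseteq> span C" "card C = dim S"
    using basis_exists by metis
  have "finite C" using independent_span_bound[OF B(1) C(2)] B(2) C(1) by auto
  then show ?thesis
    using that C span_subspace[OF C(1,3)] fin_dim_subspace[OF assms] by blast
qed

lemma fin_dim_independent_card_le:
  assumes "fin_dim Y" "independent C" "C \<subseteq> Y"
  shows "card C \<le> dim Y"
proof -
  obtain B where B: "finite B" "independent B" "span B = Y" "card B = dim Y"
    using fin_dim_basis[OF assms(1)] .
  then show "card C \<le> dim Y"
    using independent_span_bound[OF B(1) assms(2)] B assms(3) by auto
qed

lemma fin_dim_dim_mono:
  assumes "fin_dim Y" "subspace A" "A \<subseteq> Y"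
  shows "dim A \<le> dim Y"
proof -
  obtain B where B: "independent B" "span B = A" "card B = dim A"
    using fin_dim_basis[OF fin_dim_subset[OF assms]] by metis
  then show ?thesis
    using fin_dim_independent_card_le[OF assms(1) B(1)] span_superset[of B] assms(3) by auto
qed

lemma fin_dim_insert:
  assumes "fin_dim S" "v \<notin> S"
  shows "fin_dim (span (insert v S))" "dim (span (insert v S)) = Suc (dim S)"
proof -
  obtain B where B: "finite B" "independent B" "span B = S" "card B = dim S"
    using fin_dim_basis[OF assms(1)] .
  have "span (insert v S) = span (insert v B)"
    using B(3) by (metis span_insert span_span)
  moreover have "v \<notin> B" using B(3) assms(2) span_base by blast
  ultimately show "fin_dim (span (insert v S))" "dim (span (insert v S)) = Suc (dim S)"
    using B assms(2) dim_span_eq_card_independent[OF independent_insertI[of v B]]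
    by (auto simp: fin_dim_def intro!: exI[of _ "insert v B"] simp del: dim_span)
qed

lemma fin_dim_eqI:
  assumes "fin_dim Y" "subspace A" "A \<subseteq> Y" "dim A = dim Y"
  shows "A = Y"
proof (rule ccontr)
  assume "A \<noteq> Y"
  then obtain v where v: "v \<in> Y" "v \<notin> A" using assms(3) by blast
  have "span (insert v A) \<subseteq> Y"
    using v assms fin_dim_subspace by (intro span_minimal) auto
  then have "dim (span (insert v A)) \<le> dim Y"
    using assms(1) fin_dim_dim_mono subspace_span by blast
  then show False
    using fin_dim_insert(2)[OF fin_dim_subset[OF assms(1-3)] v(2)] assms(4) by simp
qed

lemma hyperplane_exists:
  assumes "fin_dim Y" "subspace P" "P \<subseteq> Y" "P \<noteq> Y"
  obtains H v where "subspace H" "P \<subseteq> H" "v \<notin> H" "span (insert v H) = Y"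
proof -
  obtain B where B: "independent B" "span B = P"
    using fin_dim_basis[OF fin_dim_subset[OF assms(1-3)]] by metis
  then have "B \<subseteq> Y" using assms(3) span_superset by blast
  then obtain C where C: "B \<subseteq> C" "C \<subseteq> Y" "independent C" "Y \<subseteq> span C"
    using maximal_independent_subset_extend[OF _ B(1)] by metis
  then have Y: "span C = Y" using assms(1) fin_dim_subspace by (intro span_subspace) auto
  then have "B \<noteq> C" using B(2) assms(4) by blast
  then obtain v where v: "v \<in> C" "v \<notin> B" using C(1) by blast
  have "v \<notin> span (C - {v})" using C(3) v(1) by (auto simp: dependent_def)
  moreover have "P \<subseteq> span (C - {v})"
    unfolding B(2)[symmetric] using C(1) v(2) by (intro span_mono) auto
  moreover have "span (insert v (span (C - {v}))) = Y"
    using v(1) Y by (metis insert_Diff span_insert span_span)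
  ultimately show ?thesis using that subspace_span by blast
qed

definition subspaces_between :: "'b set \<Rightarrow> 'b set \<Rightarrow> nat \<Rightarrow> 'b set set" where
  "subspaces_between P Y r = {A. subspace A \<and> P \<subseteq> A \<and> A \<subseteq> Y \<and> dim A = r}"

lemma mem_span_insert_subspace:
  "subspace S \<Longrightarrow> x \<in> span (insert a S) \<longleftrightarrow> (\<exists>k. x - k *s a \<in> S)"
  using span_breakdown_eq[of x a S] span_eq_iff[of S] by metis

lemma span_insert_Int_hyperplane:
  assumes "subspace A'" "A' \<subseteq> H" "subspace H" "u \<notin> H"
  shows "span (insert u A') \<inter> H = A'"
proof
  show "A' \<subseteq> span (insert u A') \<inter> H" using assms(2) by (auto intro: span_base)
  show "span (insert u A') \<inter> H \<subseteq> A'"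
  proof
    fix x assume x: "x \<in> span (insert u A') \<inter> H"
    then obtain c where c: "x - c *s u \<in> A'"
      using assms(1) by (auto simp: mem_span_insert_subspace)
    have "x - (x - c *s u) \<in> H" using x c assms subspace_diff by blast
    then have "c *s u \<in> H" by simp
    then have "c = 0"
      using assms(3,4) subspace_scale[of H "c *s u" "inverse c"] by (cases "c = 0") auto
    then show "x \<in> A'" using c by simp
  qed
qed

lemma span_insert_Int_subspace:
  assumes "subspace A" "subspace H" "u \<in> A" "A \<subseteq> span (insert u H)"
  shows "span (insert u (A \<inter> H)) = A"
proof
  show "span (insert u (A \<inter> H)) \<subseteq> A" using assms by (intro span_minimal) auto
  show "A \<subseteq> span (insert u (A \<inter> H))"
  proof
    fix x assume x: "x \<in> A"
    then have "x \<in> span (insert u H)" using assms(4) by blast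
    then obtain c where c: "x - c *s u \<in> H"
      using assms(2) by (auto simp: mem_span_insert_subspace)
    then have "x - c *s u \<in> A \<inter> H"
      using x assms(1,3) subspace_diff subspace_scale by blast
    then show "x \<in> span (insert u (A \<inter> H))"
      using span_base[of _ "A \<inter> H"] by (auto simp: span_breakdown_eq)
  qed
qed

lemma span_insert_translate:
  assumes "subspace H" "u - v \<in> H"
  shows "span (insert u H) = span (insert v H)"
proof -
  have "u \<in> span (insert v H)"
    using assms(2) span_base[of "u - v" H] by (auto simp: span_breakdown_eq intro!: exI[of _ 1])
  moreover have "v - u \<in> H" using assms subspace_neg[of H "u - v"] by simp
  then have "v \<in> span (insert u H)"
    using span_base[of "v - u" H] by (auto simp: span_breakdown_eq intro!: exI[of _ 1])
  ultimately show ?thesis by (auto simp: span_eq intro: span_base)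
qed

text \<open>Every element of the span is \<open>c *s v + h\<close> for a unique scalar \<open>c\<close> and a unique \<open>h\<close> in \<open>H\<close>.\<close>

lemma card_span_insert:
  assumes "subspace H" "v \<notin> H"
  shows "card (span (insert v H)) = CARD('a) * card H"
    and "finite (UNIV :: 'a set) \<Longrightarrow> finite H \<Longrightarrow> finite (span (insert v H))"
proof -
  have bij: "bij_betw (\<lambda>(c, h). c *s v + h) (UNIV \<times> H) (span (insert v H))"
  proof (rule bij_betw_imageI)
    show "inj_on (\<lambda>(c, h). c *s v + h) (UNIV \<times> H)"
    proof (rule inj_onI, clarify)
      fix c h c' h' assume h: "h \<in> H" "h' \<in> H" and eq: "c *s v + h = c' *s v + h'"
      have "(c - c') *s v = h' - h" using eq by (simp add: scale_left_diff_distrib algebra_simps)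
      then have "(c - c') *s v \<in> H" using h assms(1) subspace_diff by simp
      then have "c = c'"
        using assms subspace_scale[of H "(c - c') *s v" "inverse (c - c')"]
        by (cases "c = c'") auto
      then show "c = c' \<and> h = h'" using eq by simp
    qed
    show "(\<lambda>(c, h). c *s v + h) ` (UNIV \<times> H) = span (insert v H)"
    proof
      show "(\<lambda>(c, h). c *s v + h) ` (UNIV \<times> H) \<subseteq> span (insert v H)"
        by (auto intro!: span_add span_scale intro: span_base)
      show "span (insert v H) \<subseteq> (\<lambda>(c, h). c *s v + h) ` (UNIV \<times> H)"
      proof
        fix x assume "x \<in> span (insert v H)"
        then obtain c where "x - c *s v \<in> H" using assms(1) by (auto simp: mem_span_insert_subspace)
        then show "x \<in> (\<lambda>(c, h). c *s v + h) ` (UNIV \<times> H)"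
          by (intro image_eqI[of _ _ "(c, x - c *s v)"]) auto
      qed
    qed
  qed
  from bij_betw_same_card[OF bij] show "card (span (insert v H)) = CARD('a) * card H"
    by (simp add: card_cartesian_product)
  assume "finite (UNIV :: 'a set)" "finite H"
  then show "finite (span (insert v H))" using bij_betw_finite[OF bij] by simp
qed

lemma finite_card_fin_dim:
  assumes "finite (UNIV :: 'a set)" "fin_dim Y"
  shows "finite Y" "card Y = CARD('a) ^ dim Y"
proof -
  have *: "finite (span B) \<and> card (span B) = CARD('a) ^ card B" if "finite B" "independent B" for B
    using that
  proof (induction B)
    case (insert x B)
    have "independent B" using insert.prems independent_mono by blast
    moreover have "x \<notin> span B" using insert by (auto simp: independent_insert)
    moreover have "span (insert x B) = span (insert x (span B))"
      by (metis span_insert span_span)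
    ultimately show ?case
      using insert card_span_insert[OF subspace_span, of x B] assms(1) by simp
  qed simp
  obtain B where B: "finite B" "independent B" "span B = Y" "card B = dim Y"
    using fin_dim_basis[OF assms(2)] .
  with *[of B] show "finite Y" "card Y = CARD('a) ^ dim Y" by auto
qed

text \<open>Let \<open>Z\<close> be the set in question and let \<open>T\<close> be the coset \<open>v + H\<close>. Count the pairs \<open>(A, u)\<close> with
  \<open>A \<in> Z\<close> and \<open>u \<in> A \<inter> T\<close> in two ways. For each \<open>A\<close>, the set \<open>A \<inter> T\<close> is a coset of the
  \<open>(r - 1)\<close>-dimensional space \<open>A \<inter> H\<close>. On the other hand \<open>A\<close> is spanned by \<open>A \<inter> H\<close> and \<open>u\<close>,
  and every \<open>(r - 1)\<close>-dimensional space between \<open>P\<close> and \<open>H\<close> together with every \<open>u\<close> in \<open>T\<close> arises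
  from such a pair. Therefore
  \<open>card Z * q ^ (r - 1) = N * q ^ dim H\<close> for some \<open>N\<close>, and \<open>r \<le> dim H\<close> leaves a factor \<open>q\<close>.\<close>

lemma dvd_card_subspaces_not_in_hyperplane:
  assumes fin: "finite (UNIV :: 'a set)"
    and H: "fin_dim H" "v \<notin> H" "P \<subseteq> H"
    and r: "0 < r" "r \<le> dim H"
  shows "CARD('a) dvd card (subspaces_between P (span (insert v H)) r - Pow H)"
proof -
  let ?Y = "span (insert v H)" and ?q = "CARD('a)"
  let ?Z = "subspaces_between P ?Y r - Pow H"
  let ?T = "{u. u - v \<in> H}"
  have sH: "subspace H" using H(1) by (rule fin_dim_subspace)
  have fdY: "fin_dim ?Y" using fin_dim_insert(1)[OF H(1,2)] .
  have T: "u \<notin> H" "span (insert u H) = ?Y" if "u \<in> ?T" for u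
  proof -
    show "u \<notin> H" using that subspace_diff[OF sH, of u "u - v"] H(2) by auto
    show "span (insert u H) = ?Y" using span_insert_translate[OF sH] that by auto
  qed
  have Z: "card (A \<inter> ?T) = ?q ^ (r - 1)" "dim (A \<inter> H) = r - 1"
    "u \<in> A \<inter> ?T \<Longrightarrow> span (insert u (A \<inter> H)) = A" if "A \<in> ?Z" for A u
  proof -
    from that have A: "subspace A" "A \<subseteq> ?Y" "dim A = r" "\<not> A \<subseteq> H"
      by (auto simp: subspaces_between_def)
    show span: "span (insert u (A \<inter> H)) = A" if "u \<in> A \<inter> ?T" for u
      using that T(2)[of u] A(1,2) sH by (intro span_insert_Int_subspace) simp_all
    from A(4) obtain x where x: "x \<in> A" "x \<notin> H" by blast
    then obtain c where c: "x - c *s v \<in> H"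
      using A(2) mem_span_insert_subspace[OF sH, of x v] by blast
    then have c0: "c \<noteq> 0" using x by auto
    \<comment> \<open>A multiple of \<open>x\<close> lies in the coset of \<open>v\<close>.\<close>
    define w where "w = inverse c *s x"
    have "inverse c *s (x - c *s v) \<in> H" using c sH subspace_scale by blast
    then have w: "w \<in> A \<inter> ?T"
      using c0 subspace_scale[OF A(1) x(1)] by (simp add: w_def scale_right_diff_distrib)
    have fd: "fin_dim (A \<inter> H)"
      using H(1) A(1) sH by (intro fin_dim_subset[OF H(1)] subspace_inter) auto
    have "w \<notin> A \<inter> H" using w T(1)[of w] by blast
    then have "r = Suc (dim (A \<inter> H))"
      using fin_dim_insert(2)[OF fd, of w] span[OF w] A(3) by simp
    then show dimH: "dim (A \<inter> H) = r - 1" by simp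
    have "bij_betw (\<lambda>h. w + h) (A \<inter> H) (A \<inter> ?T)"
    proof (rule bij_betw_byWitness[where f' = "\<lambda>u. u - w"])
      show "(\<lambda>h. w + h) ` (A \<inter> H) \<subseteq> A \<inter> ?T"
      proof clarify
        fix h assume h: "h \<in> A" "h \<in> H"
        have "(w - v) + h \<in> H" using h w sH subspace_add by blast
        then show "w + h \<in> A \<inter> ?T"
          using h w A(1) subspace_add by (auto simp: algebra_simps)
      qed
      show "(\<lambda>u. u - w) ` (A \<inter> ?T) \<subseteq> A \<inter> H"
      proof clarify
        fix u assume u: "u \<in> A" "u - v \<in> H"
        have "(u - v) - (w - v) \<in> H" using u w sH subspace_diff by blast
        then show "u - w \<in> A \<inter> H" using u w A(1) subspace_diff by auto
      qed
    qed auto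
    from bij_betw_same_card[OF this] show "card (A \<inter> ?T) = ?q ^ (r - 1)"
      using finite_card_fin_dim(2)[OF fin fd] dimH by simp
  qed
  let ?G = "subspaces_between P H (r - 1)"
  \<comment> \<open>The number of pairs is computed by fibring over \<open>A\<close> on the left and as a product on the right.\<close>
  have "bij_betw (\<lambda>(A, u). (A \<inter> H, u)) (SIGMA A:?Z. A \<inter> ?T) (?G \<times> ?T)"
  proof (rule bij_betw_byWitness[where f' = "\<lambda>(A', u). (span (insert u A'), u)"])
    show "\<forall>p\<in>(SIGMA A:?Z. A \<inter> ?T). (\<lambda>(A', u). (span (insert u A'), u)) ((\<lambda>(A, u). (A \<inter> H, u)) p) = p"
      by (clarsimp simp: Z(3))
    show "\<forall>p\<in>?G \<times> ?T. (\<lambda>(A, u). (A \<inter> H, u)) ((\<lambda>(A', u). (span (insert u A'), u)) p) = p"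
      using T(1) sH span_insert_Int_hyperplane by (auto simp: subspaces_between_def)
    show "(\<lambda>(A, u). (A \<inter> H, u)) ` (SIGMA A:?Z. A \<inter> ?T) \<subseteq> ?G \<times> ?T"
      using Z(2) H(3) sH by (auto simp: subspaces_between_def intro!: subspace_inter)
    show "(\<lambda>(A', u). (span (insert u A'), u)) ` (?G \<times> ?T) \<subseteq> (SIGMA A:?Z. A \<inter> ?T)"
    proof clarify
      fix A' u assume A': "A' \<in> ?G" and u: "u - v \<in> H"
      have A'': "subspace A'" "A' \<subseteq> H" "P \<subseteq> A'" "dim A' = r - 1"
        using A' by (auto simp: subspaces_between_def)
      have fd: "fin_dim A'" using A'' H(1) fin_dim_subset by blast
      have uH: "u \<notin> H" using T(1) u by simp
      have "dim (span (insert u A')) = r"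
        using fin_dim_insert(2)[OF fd, of u] uH A'' r(1) by auto
      moreover have "span (insert u A') \<subseteq> ?Y"
        using T(2)[of u] u span_mono[of "insert u A'" "insert u H"] A''(2) by auto
      moreover have "u \<in> span (insert u A')" "A' \<subseteq> span (insert u A')" by (auto intro: span_base)
      ultimately show "span (insert u A') \<in> ?Z \<and> u \<in> span (insert u A') \<inter> ?T"
        using A'' uH u by (auto simp: subspaces_between_def)
    qed
  qed
  then have "card (SIGMA A:?Z. A \<inter> ?T) = card ?G * card ?T"
    by (simp add: bij_betw_same_card card_cartesian_product)
  moreover have "card ?T = ?q ^ dim H"
  proof -
    have "bij_betw (\<lambda>h. v + h) H ?T"
      by (rule bij_betw_byWitness[where f' = "\<lambda>u. u - v"]) auto
    then show ?thesis using finite_card_fin_dim(2)[OF fin H(1)] bij_betw_same_card by metis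
  qed
  moreover have "card (SIGMA A:?Z. A \<inter> ?T) = card ?Z * ?q ^ (r - 1)"
  proof -
    have finY: "finite ?Y" using finite_card_fin_dim(1)[OF fin fdY] .
    then have "finite ?Z" by (rule finite_subset[rotated, OF finite_Pow_iff[THEN iffD2]])
        (auto simp: subspaces_between_def)
    moreover have "\<forall>A\<in>?Z. finite (A \<inter> ?T)"
      using finY by (auto simp: subspaces_between_def intro: finite_subset)
    ultimately have "card (SIGMA A:?Z. A \<inter> ?T) = (\<Sum>A\<in>?Z. card (A \<inter> ?T))"
      by (rule card_SigmaI)
    then show ?thesis using Z(1) by simp
  qed
  moreover have "?q ^ dim H = ?q * ?q ^ (dim H - r) * ?q ^ (r - 1)"
    using r by (simp flip: power_Suc power_add)
  moreover have "?q > 0" using fin by (simp add: card_gt_0_iff)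
  ultimately have "card ?Z = ?q * (?q ^ (dim H - r) * card ?G)" by (auto simp: ac_simps)
  then show ?thesis by (metis dvd_triv_left)
qed

text \<open>The number of these subspaces is a Gaussian binomial coefficient, whose constant term as a
  polynomial in \<open>q\<close> is 1. The induction replaces \<open>Y\<close> by a hyperplane of \<open>Y\<close> containing \<open>P\<close>, which
  loses only a multiple of \<open>q\<close> subspaces, until the dimension of \<open>Y\<close> is \<open>r\<close>.\<close>

lemma one_modulo_subspaces_between:
  assumes "fin_dim Y" "subspace P" "P \<subseteq> Y" "dim P \<le> r" "r \<le> dim Y"
  shows "one_modulo (CARD('a)) (subspaces_between P Y r)"
  using assms
proof (induction "dim Y" arbitrary: Y rule: less_induct)
  case less
  show ?case
  proof (cases "r = dim P \<or> r = dim Y")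
    case True
    have "A = P" if "A \<in> subspaces_between P Y r" "r = dim P" for A
      using that less.prems fin_dim_eqI[OF fin_dim_subset[OF less.prems(1), of A], of P]
      by (simp add: subspaces_between_def)
    then have "subspaces_between P Y r = {P}" if "r = dim P"
      using that less.prems by (auto simp: subspaces_between_def)
    moreover have "subspaces_between P Y r = {Y}" if "r = dim Y"
      using less.prems that fin_dim_eqI[OF less.prems(1)] fin_dim_subspace
      by (auto simp: subspaces_between_def)
    ultimately have "\<exists>X. subspaces_between P Y r = {X}" using True by blast
    then show ?thesis by (auto simp: one_modulo_def)
  next
    case False
    then have r: "dim P < r" "r < dim Y" using less.prems by auto
    then have "P \<noteq> Y" by auto
    from hyperplane_exists[OF less.prems(1-3) this]
    obtain H v where H: "subspace H" "P \<subseteq> H" "v \<notin> H" "span (insert v H) = Y" .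
    have HY: "H \<subseteq> Y" unfolding H(4)[symmetric] by (auto intro: span_base)
    have fdH: "fin_dim H" using fin_dim_subset[OF less.prems(1) H(1) HY] .
    have dimY: "dim Y = Suc (dim H)" using fin_dim_insert(2)[OF fdH H(3)] H(4) by simp
    let ?Z = "subspaces_between P Y r - Pow H"
    have IH: "one_modulo CARD('a) (subspaces_between P H r)"
      using less.hyps[OF _ fdH less.prems(2) H(2)] less.prems(4) r dimY by simp
    have eq: "subspaces_between P Y r = subspaces_between P H r \<union> ?Z"
      using HY by (auto simp: subspaces_between_def)
    have "finite (subspaces_between P Y r) \<and> [card (subspaces_between P Y r) = 1] (mod CARD('a))"
      if "CARD('a) > 0"
    proof
      have fin: "finite (UNIV :: 'a set)" using that by (simp add: card_gt_0_iff)
      show finY: "finite (subspaces_between P Y r)"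
        using finite_card_fin_dim(1)[OF fin less.prems(1)]
        by (rule finite_subset[rotated, OF finite_Pow_iff[THEN iffD2]])
          (auto simp: subspaces_between_def)
      have "CARD('a) dvd card ?Z"
        using dvd_card_subspaces_not_in_hyperplane[OF fin fdH H(3,2), of r] r dimY H(4) by simp
      moreover have "card (subspaces_between P Y r) = card (subspaces_between P H r) + card ?Z"
      proof -
        have "subspaces_between P H r \<inter> ?Z = {}" by (auto simp: subspaces_between_def)
        then show ?thesis
          using eq finY card_Un_disjoint[of "subspaces_between P H r" ?Z]
          by (metis finite_Un)
      qed
      moreover have "[card (subspaces_between P H r) = 1] (mod CARD('a))"
        using IH that by (simp add: one_modulo_def)
      ultimately show "[card (subspaces_between P Y r) = 1] (mod CARD('a))"
        using cong_add[of _ 1 _ "card ?Z" 0] by (simp add: cong_0_iff)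
    qed
    moreover have "subspaces_between P Y r \<noteq> {}" using IH eq by (auto simp: one_modulo_def)
    ultimately show ?thesis by (auto simp: one_modulo_def)
  qed
qed

end

section \<open>Rank and nullity\<close>

locale subspace_counting_pair = S: subspace_counting s + T: subspace_counting t
  for s :: "'k::field \<Rightarrow> 'v::ab_group_add \<Rightarrow> 'v" and t :: "'k \<Rightarrow> 'w::ab_group_add \<Rightarrow> 'w"
begin

lemma linear_onD:
  assumes "linear_on s t X UNIV f" "S.subspace X" "x \<in> X" "y \<in> X"
  shows "f (x + y) = f x + f y" "f (s c x) = t c (f x)" "f (x - y) = f x - f y" "f 0 = 0"
proof -
  have add: "f (x + y) = f x + f y" if "x \<in> X" "y \<in> X" for x y
    using that assms(1) by (auto simp: linear_on_def)
  show "f (x + y) = f x + f y" using add assms(3,4) .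
  show "f (s c x) = t c (f x)" using assms by (auto simp: linear_on_def)
  have "f (x - y) + f y = f x" using add[of "x - y" y] assms S.subspace_diff by simp
  then show "f (x - y) = f x - f y" by (simp add: algebra_simps)
  have "0 \<in> X" using assms(2) by (rule S.subspace_0)
  then have "f (0 + 0) = f 0 + f 0" by (intro add)
  then show "f 0 = 0" by simp
qed

text \<open>The induction removes a basis vector \<open>c\<close> of the image: the preimage of the span of the
  remaining ones has the same kernel, and adding any preimage of \<open>c\<close> to it recovers \<open>X\<close>.\<close>

lemma rank_nullity_independent:
  assumes "finite C" "T.independent C" "S.subspace X" "linear_on s t X UNIV f"
    and "f ` X = T.span C" "S.fin_dim {x \<in> X. f x = 0}"
  shows "S.fin_dim X \<and> S.dim X = S.dim {x \<in> X. f x = 0} + card C"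
  using assms
proof (induction C arbitrary: X)
  case empty
  then have "{x \<in> X. f x = 0} = X" by auto
  then show ?case using empty by simp
next
  case (insert c C)
  note lin = linear_onD[OF insert.prems(3,2)]
  let ?X = "{x \<in> X. f x \<in> T.span C}"
  have indC: "T.independent C" and c: "c \<notin> T.span C"
    using insert.prems(1) insert.hyps by (auto simp: T.independent_insert)
  have "c \<in> f ` X" unfolding insert.prems(4) by (rule T.span_base) simp
  then obtain g where g: "g \<in> X" "f g = c" by auto
  have sub: "S.subspace ?X"
    using insert.prems(2) lin
    by (auto simp: S.subspace_def T.span_zero T.span_add T.span_scale)
  have lin': "linear_on s t ?X UNIV f"
    using insert.prems(3) by (auto simp: linear_on_def)
  have img: "f ` ?X = T.span C"
  proof
    show "T.span C \<subseteq> f ` ?X"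
    proof
      fix y assume y: "y \<in> T.span C"
      then have "y \<in> f ` X" unfolding insert.prems(4) using T.span_mono[of C "insert c C"] by auto
      then show "y \<in> f ` ?X" using y by auto
    qed
  qed auto
  have ker: "{x \<in> ?X. f x = 0} = {x \<in> X. f x = 0}" using T.span_zero by auto
  have IH: "S.fin_dim ?X \<and> S.dim ?X = S.dim {x \<in> X. f x = 0} + card C"
    using insert.IH[OF indC sub lin' img] insert.prems(5) unfolding ker by blast
  have "S.span (insert g ?X) = X"
  proof
    show "S.span (insert g ?X) \<subseteq> X" using g insert.prems(2) by (intro S.span_minimal) auto
    show "X \<subseteq> S.span (insert g ?X)"
    proof
      fix x assume x: "x \<in> X"
      then have "f x \<in> T.span (insert c C)" using insert.prems(4) by blast
      then obtain k where k: "f x - t k c \<in> T.span C" unfolding T.span_breakdown_eq by blast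
      have sg: "s k g \<in> X" using g insert.prems(2) S.subspace_scale by blast
      have "f (x - s k g) = f x - t k c" using lin(3)[OF x sg] lin(2)[OF g(1) g(1)] g(2) by simp
      then have "x - s k g \<in> ?X"
        using k x sg insert.prems(2) S.subspace_diff by simp
      then show "x \<in> S.span (insert g ?X)"
        using S.mem_span_insert_subspace[OF sub] by blast
    qed
  qed
  moreover have "g \<notin> ?X" using g c by simp
  ultimately show ?case
    using S.fin_dim_insert[of ?X g] IH insert.hyps by simp
qed

lemma rank_nullity:
  assumes "S.subspace X" "linear_on s t X UNIV f"
    and "S.fin_dim {x \<in> X. f x = 0}" "T.fin_dim (f ` X)"
  shows "S.fin_dim X" "S.dim X = S.dim {x \<in> X. f x = 0} + T.dim (f ` X)"
proof -
  obtain C where "finite C" "T.independent C" "T.span C = f ` X" "card C = T.dim (f ` X)"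
    using T.fin_dim_basis[OF assms(4)] .
  then show "S.fin_dim X" "S.dim X = S.dim {x \<in> X. f x = 0} + T.dim (f ` X)"
    using rank_nullity_independent[of C X f] assms by auto
qed

lemma subspace_image_linear_on:
  assumes "S.subspace X" "linear_on s t X UNIV f"
  shows "T.subspace (f ` X)"
  unfolding T.subspace_def
proof (intro conjI ballI allI)
  note lin = linear_onD[OF assms(2,1)]
  have "0 \<in> X" using assms(1) by (rule S.subspace_0)
  then show "0 \<in> f ` X" using lin(4) by (metis image_eqI)
  show "x + y \<in> f ` X" if "x \<in> f ` X" "y \<in> f ` X" for x y
  proof -
    obtain x' y' where xy: "x' \<in> X" "y' \<in> X" "x = f x'" "y = f y'" using \<open>x \<in> f ` X\<close> \<open>y \<in> f ` X\<close> by auto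
    then have "x + y = f (x' + y')" using lin(1) by simp
    then show ?thesis using xy S.subspace_add[OF assms(1)] by blast
  qed
  show "t c x \<in> f ` X" if "x \<in> f ` X" for c x
  proof -
    obtain x' where x: "x' \<in> X" "x = f x'" using \<open>x \<in> f ` X\<close> by auto
    then have "t c x = f (s c x')" using lin(2) by simp
    then show ?thesis using x S.subspace_scale[OF assms(1)] by blast
  qed
qed

lemma dim_image_inj:
  assumes "S.subspace X" "linear_on s t X UNIV f" "\<And>x. x \<in> X \<Longrightarrow> f x = 0 \<Longrightarrow> x = 0"
    and "T.fin_dim (f ` X)"
  shows "S.fin_dim X" "S.dim X = T.dim (f ` X)"
proof -
  have "0 \<in> X" using assms(1) by (rule S.subspace_0)
  moreover from this have "f 0 = 0" using linear_onD(4)[OF assms(2,1)] by blast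
  ultimately have ker: "{x \<in> X. f x = 0} = {0}" using assms(3) by auto
  have "S.span {} = {0}" by simp
  then have fd: "S.fin_dim {0}" unfolding S.fin_dim_def by blast
  have "S.dim {0} = 0" using S.dim_span_eq_card_independent[OF S.independent_empty] by simp
  then show "S.fin_dim X" "S.dim X = T.dim (f ` X)"
    using rank_nullity[OF assms(1,2) _ assms(4)] fd unfolding ker by auto
qed

end

context subspace_counting
begin

lemma subspace_counting_fun: "subspace_counting (\<lambda>c (f :: 'e \<Rightarrow> 'b) e. c *s f e)"
  by unfold_locales (auto simp: fun_eq_iff scale_right_distrib scale_left_distrib)

text \<open>Evaluation at one index maps the sum over \<open>insert e E\<close> onto \<open>W e\<close>, and its kernel is the sum
  over \<open>E\<close>.\<close>

lemma dim_direct_sum: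
  fixes W :: "'e \<Rightarrow> 'b set" and E
  defines "fscale \<equiv> \<lambda>c (f :: 'e \<Rightarrow> 'b) e. c *s f e"
  assumes "finite E" "\<And>e. e \<in> E \<Longrightarrow> fin_dim (W e)"
  shows "subspace_counting.fin_dim fscale {f. (\<forall>e\<in>E. f e \<in> W e) \<and> (\<forall>e. e \<notin> E \<longrightarrow> f e = 0)}"
    and "vector_space.dim fscale {f. (\<forall>e\<in>E. f e \<in> W e) \<and> (\<forall>e. e \<notin> E \<longrightarrow> f e = 0)}
           = (\<Sum>e\<in>E. dim (W e))"
proof -
  interpret F: subspace_counting fscale
    unfolding fscale_def by (rule subspace_counting_fun)
  interpret FV: subspace_counting_pair fscale scale ..
  let ?X = "\<lambda>E. {f. (\<forall>e\<in>E. f e \<in> W e) \<and> (\<forall>e. e \<notin> E \<longrightarrow> f e = 0)}"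
  have "F.fin_dim (?X E) \<and> F.dim (?X E) = (\<Sum>e\<in>E. dim (W e))"
    using assms(2,3)
  proof (induction E)
    case empty
    have "?X {} = {0}" by (auto simp: fun_eq_iff)
    moreover have "F.span {} = {0}" by simp
    moreover have "F.dim {0} = 0" using F.dim_span_eq_card_independent[OF F.independent_empty] by simp
    ultimately show ?case by (auto simp: F.fin_dim_def)
  next
    case (insert e E)
    then have W: "subspace (W e')" if "e' \<in> insert e E" for e' using that fin_dim_subspace by blast
    let ?Y = "?X (insert e E)"
    have sub: "F.subspace ?Y"
      unfolding F.subspace_def
      using W by (auto simp: fscale_def subspace_0 subspace_add subspace_scale)
    have ker: "{f \<in> ?Y. f e = 0} = ?X E"
      using insert.hyps subspace_0[OF W[of e]] by (auto; metis)
    have img: "(\<lambda>f. f e) ` ?Y = W e"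
    proof
      show "W e \<subseteq> (\<lambda>f. f e) ` ?Y"
      proof
        fix x assume "x \<in> W e"
        then have "(\<lambda>e'. if e' = e then x else 0) \<in> ?Y" using W subspace_0 by auto
        then show "x \<in> (\<lambda>f. f e) ` ?Y" by (rule rev_image_eqI) simp
      qed
    qed auto
    have lin: "linear_on fscale scale ?Y UNIV (\<lambda>f. f e)"
      by (auto simp: linear_on_def fscale_def)
    have IH: "F.fin_dim (?X E) \<and> F.dim (?X E) = (\<Sum>e\<in>E. dim (W e))"
      using insert by blast
    have "fin_dim (W e)" using insert.prems by simp
    then show ?case
      using FV.rank_nullity[OF sub lin] IH insert.hyps unfolding ker img by simp
  qed
  then show "F.fin_dim (?X E)" "F.dim (?X E) = (\<Sum>e\<in>E. dim (W e))" by auto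
qed

end

section \<open>Subrepresentations of a representation and of its reflection\<close>

locale sink_reflection =
  fixes Q :: "('i, 'e) pre_digraph" and a :: 'i
    and M :: "('i, 'e, 'k::field, 'v::ab_group_add) quiver_rep"
  assumes fin_Q: "fin_digraph Q" and sink: "sink Q a" and rep: "quiver_representation Q M"
begin

sublocale S: subspace_counting "scl M"
  using rep by (simp add: quiver_representation_def subspace_counting_def)

lemma scl_reflect_rep: "scl (reflect_rep Q a M) c p = (scl M c (fst p), \<lambda>e. scl M c (snd p e))"
  by (simp add: reflect_rep_def case_prod_beta)

sublocale R: subspace_counting "scl (reflect_rep Q a M)"
  by unfold_locales
    (auto simp: scl_reflect_rep prod_eq_iff fun_eq_iff S.scale_right_distrib S.scale_left_distrib)

sublocale F: subspace_counting "\<lambda>c (f :: 'e \<Rightarrow> 'v) e. scl M c (f e)"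
  by (rule S.subspace_counting_fun)

lemma finite_verts: "finite (verts Q)" and finite_arcs: "finite (arcs Q)"
  and tail_in_verts: "\<alpha> \<in> arcs Q \<Longrightarrow> tail Q \<alpha> \<in> verts Q"
  and head_in_verts: "\<alpha> \<in> arcs Q \<Longrightarrow> head Q \<alpha> \<in> verts Q"
proof -
  interpret fin_digraph Q by (rule fin_Q)
  show "finite (verts Q)" "finite (arcs Q)" by simp_all
  show "\<alpha> \<in> arcs Q \<Longrightarrow> tail Q \<alpha> \<in> verts Q" "\<alpha> \<in> arcs Q \<Longrightarrow> head Q \<alpha> \<in> verts Q" by simp_all
qed

lemma finite_in_arcs: "finite (in_arcs Q a)"
  using finite_arcs by (rule finite_subset[rotated]) auto

lemma a_in_verts: "a \<in> verts Q" and tail_neq_sink: "\<alpha> \<in> arcs Q \<Longrightarrow> tail Q \<alpha> \<noteq> a"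
  using sink by (auto simp: sink_def out_arcs_def)

lemma vsp_fin_dim: "i \<in> verts Q \<Longrightarrow> S.fin_dim (vsp M i)"
  and vmap_linear: "\<alpha> \<in> arcs Q \<Longrightarrow>
    linear_on (scl M) (scl M) (vsp M (tail Q \<alpha>)) (vsp M (head Q \<alpha>)) (vmap M \<alpha>)"
  using rep by (auto simp: quiver_representation_def S.fin_dim_def)

definition incoming :: "('i \<Rightarrow> 'v set) \<Rightarrow> ('e \<Rightarrow> 'v) set" where
  "incoming U = {f. (\<forall>\<alpha>\<in>in_arcs Q a. f \<alpha> \<in> U (tail Q \<alpha>)) \<and> (\<forall>\<alpha>. \<alpha> \<notin> in_arcs Q a \<longrightarrow> f \<alpha> = 0)}"

text \<open>For a family of subspaces with direct sum \<open>X\<close> over the arrows into \<open>a\<close>, this is \<open>\<phi>(X)\<close>, and \<open>incoming_kernel\<close> is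
  \<open>X \<inter> ker \<phi>\<close>, placed in the ambient space of the reflected representation.\<close>

definition incoming_image :: "('i \<Rightarrow> 'v set) \<Rightarrow> 'v set" where
  "incoming_image U = phi Q a M ` incoming U"

definition incoming_kernel :: "('i \<Rightarrow> 'v set) \<Rightarrow> ('v \<times> ('e \<Rightarrow> 'v)) set" where
  "incoming_kernel U = {0} \<times> {f \<in> incoming U. phi Q a M f = 0}"

lemma incoming_sum_eq: "incoming_sum Q a M = incoming (vsp M)"
  by (simp add: incoming_sum_def incoming_def)

lemma vsp_reflect_rep_sink: "vsp (reflect_rep Q a M) a = incoming_kernel (vsp M)"
  by (simp add: reflect_rep_def incoming_kernel_def incoming_sum_eq)

lemma incoming_mono:
  assumes "\<And>i. i \<in> verts Q - {a} \<Longrightarrow> U i \<subseteq> U' i"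
  shows "incoming U \<subseteq> incoming U'" "incoming_image U \<subseteq> incoming_image U'"
    "incoming_kernel U \<subseteq> incoming_kernel U'"
proof -
  show "incoming U \<subseteq> incoming U'"
    using assms tail_in_verts tail_neq_sink by (fastforce simp: incoming_def)
  then show "incoming_image U \<subseteq> incoming_image U'" "incoming_kernel U \<subseteq> incoming_kernel U'"
    by (auto simp: incoming_image_def incoming_kernel_def)
qed

definition subspace_family :: "('i \<Rightarrow> 'v set) \<Rightarrow> bool" where
  "subspace_family U \<longleftrightarrow> (\<forall>i\<in>verts Q - {a}. S.subspace (U i) \<and> U i \<subseteq> vsp M i)"

lemma subspace_family_vsp: "subspace_family (vsp M)"
  using vsp_fin_dim S.fin_dim_subspace by (auto simp: subspace_family_def)

lemma subspace_familyD:
  assumes "subspace_family U" "\<alpha> \<in> in_arcs Q a"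
  shows "S.subspace (U (tail Q \<alpha>))" "U (tail Q \<alpha>) \<subseteq> vsp M (tail Q \<alpha>)" "S.fin_dim (U (tail Q \<alpha>))"
proof -
  have "tail Q \<alpha> \<in> verts Q - {a}" using assms(2) tail_in_verts tail_neq_sink by auto
  then show "S.subspace (U (tail Q \<alpha>))" "U (tail Q \<alpha>) \<subseteq> vsp M (tail Q \<alpha>)" "S.fin_dim (U (tail Q \<alpha>))"
    using assms(1) S.fin_dim_subset[OF vsp_fin_dim] by (auto simp: subspace_family_def)
qed

lemma incoming_subspace: 
  assumes "subspace_family U"
  shows "F.subspace (incoming U)"
  using subspace_familyD[OF assms] unfolding F.subspace_def
  by (auto simp: incoming_def S.subspace_0 S.subspace_add S.subspace_scale)

lemma phi_linear: "linear_on (\<lambda>c f e. scl M c (f e)) (scl M) (incoming (vsp M)) UNIV (phi Q a M)"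
  unfolding linear_on_def
proof (intro conjI ballI allI)
  have lin: "vmap M \<alpha> (x + y) = vmap M \<alpha> x + vmap M \<alpha> y"
    "vmap M \<alpha> (scl M c x) = scl M c (vmap M \<alpha> x)"
    if "\<alpha> \<in> arcs Q" "x \<in> vsp M (tail Q \<alpha>)" "y \<in> vsp M (tail Q \<alpha>)" for \<alpha> x y c
    using vmap_linear[of \<alpha>] that by (auto simp: linear_on_def)
  fix f assume f: "f \<in> incoming (vsp M)"
  show "phi Q a M (f + g) = phi Q a M f + phi Q a M g" if "g \<in> incoming (vsp M)" for g
    using f that unfolding phi_def sum.distrib[symmetric]
    by (intro sum.cong refl) (auto simp: incoming_def lin)
  show "phi Q a M (\<lambda>e. scl M c (f e)) = scl M c (phi Q a M f)" for c
    using f unfolding phi_def S.scale_sum_right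
    by (intro sum.cong refl lin(2)) (auto simp: incoming_def)
qed simp

lemma linear_on_subset: "linear_on s t X Y f \<Longrightarrow> X' \<subseteq> X \<Longrightarrow> linear_on s t X' UNIV f"
  unfolding linear_on_def by blast

sublocale FS: subspace_counting_pair "\<lambda>c (f :: 'e \<Rightarrow> 'v) e. scl M c (f e)" "scl M" ..
sublocale RF: subspace_counting_pair "scl (reflect_rep Q a M)" "\<lambda>c (f :: 'e \<Rightarrow> 'v) e. scl M c (f e)" ..
sublocale RS: subspace_counting_pair "scl (reflect_rep Q a M)" "scl M" ..

lemma subspace_times_zero: "R.subspace (W \<times> {0}) \<longleftrightarrow> S.subspace W"
  unfolding R.subspace_def S.subspace_def
  by (auto simp: scl_reflect_rep zero_prod_def zero_fun_def)

lemma dim_times_zero: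
  assumes "S.fin_dim W"
  shows "R.dim (W \<times> {0}) = S.dim W"
proof -
  have "fst ` (W \<times> {0 :: 'e \<Rightarrow> 'v}) = W" by force
  moreover have "linear_on (scl (reflect_rep Q a M)) (scl M) (W \<times> {0}) UNIV fst"
    by (auto simp: linear_on_def scl_reflect_rep)
  ultimately show ?thesis
    using RS.dim_image_inj(2)[of "W \<times> {0}" fst] assms S.fin_dim_subspace
    by (auto simp: subspace_times_zero zero_prod_def)
qed

lemma subspace_zero_times: "R.subspace ({0} \<times> W) \<longleftrightarrow> F.subspace W"
  unfolding R.subspace_def F.subspace_def
  by (auto simp: scl_reflect_rep zero_prod_def)

lemma zero_times:
  assumes "F.fin_dim W"
  shows "R.fin_dim ({0} \<times> W)" "R.dim ({0} \<times> W) = F.dim W"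
proof -
  have "snd ` ({0 :: 'v} \<times> W) = W" by force
  moreover have "linear_on (scl (reflect_rep Q a M)) (\<lambda>c f e. scl M c (f e)) ({0} \<times> W) UNIV snd"
    by (auto simp: linear_on_def scl_reflect_rep)
  ultimately show "R.fin_dim ({0} \<times> W)" "R.dim ({0} \<times> W) = F.dim W"
    using RF.dim_image_inj[of "{0} \<times> W" snd] assms F.fin_dim_subspace
    by (auto simp: subspace_zero_times zero_prod_def)
qed

text \<open>The dimension formula is rank and nullity for \<open>\<phi>\<close> on the direct sum of the given subspaces.\<close>

lemma incoming_dims:
  assumes "subspace_family U"
  shows "S.subspace (incoming_image U)" "R.fin_dim (incoming_kernel U)"
    "S.dim (incoming_image U) + R.dim (incoming_kernel U) = (\<Sum>\<alpha>\<in>in_arcs Q a. S.dim (U (tail Q \<alpha>)))"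
    "incoming_image U \<subseteq> vsp M a"
proof -
  have sub: "F.subspace (incoming U)" using assms by (rule incoming_subspace)
  have "incoming U \<subseteq> incoming (vsp M)"
    using assms by (intro incoming_mono(1)) (auto simp: subspace_family_def)
  then have lin: "linear_on (\<lambda>c f e. scl M c (f e)) (scl M) (incoming U) UNIV (phi Q a M)"
    using linear_on_subset[OF phi_linear] by blast
  have X: "F.fin_dim (incoming U)" "F.dim (incoming U) = (\<Sum>\<alpha>\<in>in_arcs Q a. S.dim (U (tail Q \<alpha>)))"
    using S.dim_direct_sum[OF finite_in_arcs, of "\<lambda>\<alpha>. U (tail Q \<alpha>)"] subspace_familyD(3)[OF assms]
    by (simp_all add: incoming_def)
  let ?N = "{f \<in> incoming U. phi Q a M f = 0}"
  note linD = FS.linear_onD[OF lin sub]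
  have "F.subspace ?N"
    using sub linD F.subspace_0[OF sub] unfolding F.subspace_def by auto
  then have N: "F.fin_dim ?N" using F.fin_dim_subset[OF X(1)] by blast
  then show "R.fin_dim (incoming_kernel U)" by (simp add: incoming_kernel_def zero_times)
  show subI: "S.subspace (incoming_image U)"
    unfolding incoming_image_def using sub lin by (rule FS.subspace_image_linear_on)
  show "incoming_image U \<subseteq> vsp M a"
  proof
    fix y assume "y \<in> incoming_image U"
    then obtain f where f: "f \<in> incoming U" "y = (\<Sum>\<alpha>\<in>in_arcs Q a. vmap M \<alpha> (f \<alpha>))"
      by (auto simp: incoming_image_def phi_def)
    have "vmap M \<alpha> (f \<alpha>) \<in> vsp M a" if "\<alpha> \<in> in_arcs Q a" for \<alpha>
    proof -
      have "f \<alpha> \<in> vsp M (tail Q \<alpha>)"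
        using that f(1) subspace_familyD(2)[OF assms that] by (auto simp: incoming_def)
      then show ?thesis
        using that vmap_linear[of \<alpha>] by (auto simp: linear_on_def)
    qed
    then show "y \<in> vsp M a"
      unfolding f(2) using vsp_fin_dim[OF a_in_verts] S.fin_dim_subspace by (intro S.subspace_sum) auto
  qed
  then have "S.fin_dim (incoming_image U)"
    using S.fin_dim_subset[OF vsp_fin_dim[OF a_in_verts] subI] by blast
  then have "F.dim (incoming U) = F.dim ?N + S.dim (incoming_image U)"
    unfolding incoming_image_def using FS.rank_nullity(2)[OF sub lin N] by blast
  then show "S.dim (incoming_image U) + R.dim (incoming_kernel U) = (\<Sum>\<alpha>\<in>in_arcs Q a. S.dim (U (tail Q \<alpha>)))"
    using X(2) zero_times(2)[OF N] by (simp add: incoming_kernel_def)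
qed

lemma incoming_image_subset_iff:
  assumes "subspace_family U" "S.subspace A"
  shows "incoming_image U \<subseteq> A \<longleftrightarrow> (\<forall>\<alpha>\<in>in_arcs Q a. vmap M \<alpha> ` U (tail Q \<alpha>) \<subseteq> A)"
proof
  assume L: "incoming_image U \<subseteq> A"
  show "\<forall>\<alpha>\<in>in_arcs Q a. vmap M \<alpha> ` U (tail Q \<alpha>) \<subseteq> A"
  proof clarify
    fix \<alpha> x assume \<alpha>: "\<alpha> \<in> in_arcs Q a" and x: "x \<in> U (tail Q \<alpha>)"
    let ?f = "\<lambda>\<beta>. if \<beta> = \<alpha> then x else 0"
    have "vmap M \<beta> 0 = 0" if "\<beta> \<in> in_arcs Q a" for \<beta>
    proof -
      interpret SS: subspace_counting_pair "scl M" "scl M" ..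
      from that vmap_linear[of \<beta>] have "linear_on (scl M) (scl M) (vsp M (tail Q \<beta>)) UNIV (vmap M \<beta>)"
        by (auto intro: linear_on_subset)
      then show ?thesis
        using SS.linear_onD(4) subspace_familyD(1)[OF subspace_family_vsp that] S.subspace_0 by blast
    qed
    then have "phi Q a M ?f = (\<Sum>\<beta>\<in>in_arcs Q a. if \<beta> = \<alpha> then vmap M \<alpha> x else 0)"
      unfolding phi_def by (intro sum.cong) auto
    also have "\<dots> = vmap M \<alpha> x" using \<alpha> finite_in_arcs by simp
    finally have "vmap M \<alpha> x = phi Q a M ?f" by simp
    moreover have "?f \<in> incoming U"
      using \<alpha> x S.subspace_0[OF subspace_familyD(1)[OF assms(1)]] by (auto simp: incoming_def)
    ultimately show "vmap M \<alpha> x \<in> A" using L by (auto simp: incoming_image_def)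
  qed
next
  assume "\<forall>\<alpha>\<in>in_arcs Q a. vmap M \<alpha> ` U (tail Q \<alpha>) \<subseteq> A"
  then show "incoming_image U \<subseteq> A"
    using assms(2)
    by (auto simp: incoming_image_def phi_def incoming_def image_subset_iff intro!: S.subspace_sum)
qed

text \<open>Given the components off the sink, the arrows into \<open>a\<close> bound the component at \<open>a\<close> from below.\<close>

lemma subrep_glue:
  fixes U A
  defines "V \<equiv> \<lambda>i\<in>verts Q. if i = a then A else U i"
  shows "subrep Q M V \<longleftrightarrow>
    subspace_family U \<and> (\<forall>\<alpha>\<in>arcs Q - in_arcs Q a. vmap M \<alpha> ` U (tail Q \<alpha>) \<subseteq> U (head Q \<alpha>)) \<and>
    S.subspace A \<and> A \<subseteq> vsp M a \<and> incoming_image U \<subseteq> A"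
proof -
  have Va: "V a = A" using a_in_verts by (simp add: V_def)
  have Vi: "V i = U i" if "i \<in> verts Q" "i \<noteq> a" for i using that by (simp add: V_def)
  have Vt: "V (tail Q \<alpha>) = U (tail Q \<alpha>)" if "\<alpha> \<in> arcs Q" for \<alpha>
    using that tail_in_verts tail_neq_sink by (simp add: Vi)
  have Vh: "V (head Q \<alpha>) = (if \<alpha> \<in> in_arcs Q a then A else U (head Q \<alpha>))" if "\<alpha> \<in> arcs Q" for \<alpha>
    using that head_in_verts Va by (auto simp: Vi)
  have verts: "(\<forall>i\<in>verts Q. P i) \<longleftrightarrow> P a \<and> (\<forall>i\<in>verts Q - {a}. P i)" for P
    using a_in_verts by auto
  have arcs: "(\<forall>\<alpha>\<in>arcs Q. P \<alpha>) \<longleftrightarrow> (\<forall>\<alpha>\<in>in_arcs Q a. P \<alpha>) \<and> (\<forall>\<alpha>\<in>arcs Q - in_arcs Q a. P \<alpha>)" for P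
    by auto
  have "(\<forall>i\<in>verts Q. S.subspace (V i) \<and> V i \<subseteq> vsp M i) \<longleftrightarrow>
      (S.subspace A \<and> A \<subseteq> vsp M a) \<and> subspace_family U"
    unfolding verts Va subspace_family_def by (auto simp: Vi)
  moreover have "(\<forall>\<alpha>\<in>arcs Q. vmap M \<alpha> ` V (tail Q \<alpha>) \<subseteq> V (head Q \<alpha>)) \<longleftrightarrow>
      (\<forall>\<alpha>\<in>in_arcs Q a. vmap M \<alpha> ` U (tail Q \<alpha>) \<subseteq> A) \<and>
      (\<forall>\<alpha>\<in>arcs Q - in_arcs Q a. vmap M \<alpha> ` U (tail Q \<alpha>) \<subseteq> U (head Q \<alpha>))"
    unfolding arcs by (intro arg_cong2[of _ _ _ _ "(\<and>)"] ball_cong refl) (simp_all add: Vt Vh Va)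
  ultimately show ?thesis
    unfolding subrep_def using incoming_image_subset_iff[of U A] by argo
qed

text \<open>After the reflection the arrows at \<open>a\<close> point outwards and bound the component at \<open>a\<close> from
  above, while the conditions off \<open>a\<close> are the same as in \<open>subrep_glue\<close>.\<close>

lemma subrep_reflect_glue:
  fixes U A
  defines "V \<equiv> \<lambda>i\<in>verts Q. if i = a then A else U i \<times> {0}"
  shows "subrep (reflect_quiver Q a) (reflect_rep Q a M) V \<longleftrightarrow>
    subspace_family U \<and> (\<forall>\<alpha>\<in>arcs Q - in_arcs Q a. vmap M \<alpha> ` U (tail Q \<alpha>) \<subseteq> U (head Q \<alpha>)) \<and>
    R.subspace A \<and> A \<subseteq> incoming_kernel U"
proof -
  let ?Q = "reflect_quiver Q a" and ?M = "reflect_rep Q a M"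
  have Va: "V a = A" using a_in_verts by (simp add: V_def)
  have Vi: "V i = U i \<times> {0}" if "i \<in> verts Q" "i \<noteq> a" for i using that by (simp add: V_def)
  have Vt: "V (tail Q \<alpha>) = U (tail Q \<alpha>) \<times> {0}" if "\<alpha> \<in> arcs Q" for \<alpha>
    using that tail_in_verts tail_neq_sink by (simp add: Vi)
  have Vh: "V (head Q \<alpha>) = U (head Q \<alpha>) \<times> {0}" if "\<alpha> \<in> arcs Q - in_arcs Q a" for \<alpha>
    using that head_in_verts by (simp add: Vi)
  have verts: "(\<forall>i\<in>verts Q. P i) \<longleftrightarrow> P a \<and> (\<forall>i\<in>verts Q - {a}. P i)" for P
    using a_in_verts by auto
  have arcs: "(\<forall>\<alpha>\<in>arcs Q. P \<alpha>) \<longleftrightarrow> (\<forall>\<alpha>\<in>in_arcs Q a. P \<alpha>) \<and> (\<forall>\<alpha>\<in>arcs Q - in_arcs Q a. P \<alpha>)" for P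
    by auto
  have vsp: "vsp ?M i = vsp M i \<times> {0}" if "i \<noteq> a" for i using that by (simp add: reflect_rep_def)
  have "(\<forall>i\<in>verts Q. R.subspace (V i) \<and> V i \<subseteq> vsp ?M i) \<longleftrightarrow>
      (R.subspace A \<and> A \<subseteq> incoming_kernel (vsp M)) \<and> subspace_family U"
    unfolding verts Va vsp_reflect_rep_sink subspace_family_def
    by (intro arg_cong2[of _ _ _ _ "(\<and>)"] ball_cong refl)
      (auto simp: Vi vsp subspace_times_zero times_subset_iff)
  moreover have "(\<forall>\<alpha>\<in>arcs Q. vmap ?M \<alpha> ` V (tail ?Q \<alpha>) \<subseteq> V (head ?Q \<alpha>)) \<longleftrightarrow>
      (\<forall>\<alpha>\<in>in_arcs Q a. \<forall>p\<in>A. snd p \<alpha> \<in> U (tail Q \<alpha>)) \<and>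
      (\<forall>\<alpha>\<in>arcs Q - in_arcs Q a. vmap M \<alpha> ` U (tail Q \<alpha>) \<subseteq> U (head Q \<alpha>))"
    unfolding arcs
  proof (intro arg_cong2[of _ _ _ _ "(\<and>)"] ball_cong refl)
    fix \<alpha> assume \<alpha>: "\<alpha> \<in> in_arcs Q a"
    then have "tail ?Q \<alpha> = a" "head ?Q \<alpha> = tail Q \<alpha>" by (auto simp: reflect_quiver_def)
    moreover have "vmap ?M \<alpha> = (\<lambda>p. (snd p \<alpha>, 0))"
      using \<alpha> by (auto simp: reflect_rep_def fun_eq_iff)
    ultimately show "vmap ?M \<alpha> ` V (tail ?Q \<alpha>) \<subseteq> V (head ?Q \<alpha>) \<longleftrightarrow> (\<forall>p\<in>A. snd p \<alpha> \<in> U (tail Q \<alpha>))"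
      using \<alpha> Vt[of \<alpha>] Va by (auto simp: image_subset_iff)
  next
    fix \<alpha> assume \<alpha>: "\<alpha> \<in> arcs Q - in_arcs Q a"
    then have "tail ?Q \<alpha> = tail Q \<alpha>" "head ?Q \<alpha> = head Q \<alpha>"
      using tail_neq_sink by (auto simp: reflect_quiver_def)
    moreover have "vmap ?M \<alpha> = (\<lambda>p. (vmap M \<alpha> (fst p), 0))"
      using \<alpha> by (auto simp: reflect_rep_def fun_eq_iff)
    ultimately show "vmap ?M \<alpha> ` V (tail ?Q \<alpha>) \<subseteq> V (head ?Q \<alpha>) \<longleftrightarrow>
        vmap M \<alpha> ` U (tail Q \<alpha>) \<subseteq> U (head Q \<alpha>)"
      using \<alpha> Vt[of \<alpha>] Vh[of \<alpha>] by (auto simp: image_subset_iff)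
  qed
  moreover have "A \<subseteq> incoming_kernel U \<longleftrightarrow>
      A \<subseteq> incoming_kernel (vsp M) \<and> (\<forall>\<alpha>\<in>in_arcs Q a. \<forall>p\<in>A. snd p \<alpha> \<in> U (tail Q \<alpha>))"
    if "subspace_family U"
  proof
    assume A: "A \<subseteq> incoming_kernel U"
    have "snd p \<alpha> \<in> U (tail Q \<alpha>)" if "p \<in> A" "\<alpha> \<in> in_arcs Q a" for p \<alpha>
      using that subsetD[OF A that(1)] unfolding incoming_kernel_def incoming_def by fastforce
    moreover have "incoming_kernel U \<subseteq> incoming_kernel (vsp M)"
      using that by (intro incoming_mono(3)) (simp add: subspace_family_def)
    ultimately show "A \<subseteq> incoming_kernel (vsp M) \<and> (\<forall>\<alpha>\<in>in_arcs Q a. \<forall>p\<in>A. snd p \<alpha> \<in> U (tail Q \<alpha>))"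
      using A by blast
  qed (fastforce simp: incoming_kernel_def incoming_def)
  moreover have "verts ?Q = verts Q" "arcs ?Q = arcs Q" by (simp_all add: reflect_quiver_def)
  ultimately show ?thesis
    unfolding subrep_def by (simp only:) argo
qed

end

section \<open>The spaces at the sink and at the source over a fixed flag\<close>

lemma reflect_dim_sink:
  assumes "fin_digraph Q" "sink Q a"
  shows "reflect_dim Q a d a = (\<Sum>\<alpha>\<in>in_arcs Q a. d (tail Q \<alpha>)) - d a"
proof -
  interpret fin_digraph Q by fact
  have a: "a \<in> verts Q" and tail: "tail Q \<alpha> \<noteq> a" if "\<alpha> \<in> arcs Q" for \<alpha>
    using assms(2) that by (auto simp: sink_def)
  have a: "a \<in> verts Q" using assms(2) by (simp add: sink_def)
  have "(\<Sum>\<alpha>\<in>arcs Q. d (tail Q \<alpha>) * unit_dim a (head Q \<alpha>)) = (\<Sum>\<alpha>\<in>in_arcs Q a. d (tail Q \<alpha>))"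
    by (rule sum.mono_neutral_cong_right) (auto simp: unit_dim_def)
  moreover have "(\<Sum>\<alpha>\<in>arcs Q. unit_dim a (tail Q \<alpha>) * d (head Q \<alpha>)) = 0"
    using tail by (intro sum.neutral) (auto simp: unit_dim_def)
  moreover have "(\<Sum>i\<in>verts Q. d i * unit_dim a i) = d a" "(\<Sum>i\<in>verts Q. unit_dim a i * d i) = d a"
    using a by (auto simp: unit_dim_def if_distrib if_distribR sum.delta cong: if_cong)
  ultimately show ?thesis
    by (simp add: reflect_dim_def sym_euler_form_def euler_form_def unit_dim_def)
qed

locale filtration_reflection = sink_reflection Q a M
  for Q :: "('i, 'e) pre_digraph" and a :: 'i
    and M :: "('i, 'e, 'k::field, 'v::ab_group_add) quiver_rep" +
  fixes \<nu> :: nat and d :: "nat \<Rightarrow> 'i \<Rightarrow> int"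
  assumes filt: "filtration Q \<nu> d" and dimM: "\<And>i. i \<in> verts Q \<Longrightarrow> dim_vector M i = d \<nu> i"
begin

text \<open>This is the entry of \<open>\<sigma>\<^sub>a d\<^sup>l\<close> at \<open>a\<close>, and it equals \<open>dim X\<^sub>l - d\<^sub>l\<close> for the direct sum \<open>X\<^sub>l\<close> of the
  components of a flag over the arrows into \<open>a\<close>.\<close>

definition excess :: "nat \<Rightarrow> int" where
  "excess l = (\<Sum>\<alpha>\<in>in_arcs Q a. d l (tail Q \<alpha>)) - d l a"

abbreviation refl_d :: "nat \<Rightarrow> 'i \<Rightarrow> int" where
  "refl_d \<equiv> reflect_filtration Q a M \<nu> d"

lemma d_0: "i \<in> verts Q \<Longrightarrow> d 0 i = 0"
  and d_mono: "l < \<nu> \<Longrightarrow> i \<in> verts Q \<Longrightarrow> d l i \<le> d (Suc l) i"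
  using filt by (auto simp: filtration_def)

lemma d_nonneg: "l \<le> \<nu> \<Longrightarrow> i \<in> verts Q \<Longrightarrow> 0 \<le> d l i"
proof (induction l)
  case (Suc l)
  then show ?case using d_mono[of l i] by simp
qed (simp add: d_0)

lemma excess_0: "excess 0 = 0"
  using tail_in_verts a_in_verts by (auto simp: excess_def d_0)

lemma r_plus_Suc: "r_plus Q a d (Suc l) = max 0 (excess l - excess (Suc l) + r_plus Q a d l)"
  by (simp add: reflect_dim_sink[OF fin_Q sink] excess_def sum_subtractf)

lemma refl_d_sink: "l < \<nu> \<Longrightarrow> refl_d l a = excess l + r_plus Q a d l"
  using excess_0
  by (auto simp: reflect_filtration_def unit_dim_def reflect_dim_sink[OF fin_Q sink] excess_def)

text \<open>The correction \<open>r\<^sub>+\<close> is exactly what makes the reflected entry at \<open>a\<close> the running maximum of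
  \<open>excess\<close>, so that a chain with these dimensions can exist at all.\<close>

lemma refl_d_sink_Suc:
  assumes "Suc l < \<nu>"
  shows "refl_d (Suc l) a = max (excess (Suc l)) (refl_d l a)"
  using assms by (simp add: refl_d_sink r_plus_Suc del: r_plus.simps)

lemma refl_d_off_sink:
  assumes "i \<in> verts Q - {a}" "l \<le> \<nu>"
  shows "refl_d l i = d l i"
proof (cases "l = 0 \<or> l < \<nu>")
  case True
  then show ?thesis
    using assms d_0 by (auto simp: reflect_filtration_def reflect_dim_def unit_dim_def)
next
  case False
  then have "refl_d l i = int (R.dim (vsp M i \<times> {0}))" "l = \<nu>"
    using assms by (simp_all add: reflect_filtration_def dim_vector_def reflect_rep_def)
  then show ?thesis
    using assms dimM[of i] dim_times_zero[OF vsp_fin_dim, of i] by (simp add: dim_vector_def)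
qed

lemma refl_d_0: "refl_d 0 a = 0"
  by (simp add: reflect_filtration_def)

text \<open>For \<open>\<nu> = 0\<close> the reflected filtration ends with 0 instead of the dimension vector of the reflected
  representation, but then \<open>M\<close> is zero and so is its reflection.\<close>

lemma refl_d_top: "refl_d \<nu> a = int (R.dim (incoming_kernel (vsp M)))"
proof (cases "\<nu> = 0")
  case True
  then have "S.dim (vsp M (tail Q \<alpha>)) = 0" if "\<alpha> \<in> in_arcs Q a" for \<alpha>
    using dimM[of "tail Q \<alpha>"] that tail_in_verts d_0 by (auto simp: dim_vector_def)
  then have "R.dim (incoming_kernel (vsp M)) = 0"
    using incoming_dims(3)[OF subspace_family_vsp] by simp
  then show ?thesis using True refl_d_0 by simp
next
  case False
  then show ?thesis
    by (simp add: reflect_filtration_def dim_vector_def vsp_reflect_rep_sink)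
qed

lemma refl_d_nonneg: "l \<le> \<nu> \<Longrightarrow> 0 \<le> refl_d l a"
proof (cases "l = \<nu>")
  case False
  have "0 \<le> refl_d l a" if "l < \<nu>"
    using that
  proof (induction l)
    case (Suc l)
    then show ?case using refl_d_sink_Suc[of l] by simp
  qed (simp add: refl_d_0)
  then show "l \<le> \<nu> \<Longrightarrow> 0 \<le> refl_d l a" using False by simp
qed (simp add: refl_d_top)

text \<open>The candidates for the part off \<open>a\<close> of a flag. They are the same for \<open>M\<close> and for its reflection,
  where each component \<open>W\<close> appears as \<open>W \<times> {0}\<close>.\<close>

definition flag_base :: "(nat \<Rightarrow> 'i \<Rightarrow> 'v set) set" where
  "flag_base = {B \<in> {..\<nu>} \<rightarrow>\<^sub>E ((verts Q - {a}) \<rightarrow>\<^sub>E UNIV).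
     (\<forall>l\<le>\<nu>. subspace_family (B l) \<and>
        (\<forall>\<alpha>\<in>arcs Q - in_arcs Q a. vmap M \<alpha> ` B l (tail Q \<alpha>) \<subseteq> B l (head Q \<alpha>)) \<and>
        (\<forall>i\<in>verts Q - {a}. int (S.dim (B l i)) = d l i)) \<and>
     (\<forall>l<\<nu>. \<forall>i\<in>verts Q - {a}. B l i \<subseteq> B (Suc l) i) \<and>
     (\<forall>i\<in>verts Q - {a}. B \<nu> i = vsp M i)}"

text \<open>The candidates for the \<open>l\<close>-th component at \<open>a\<close> of a flag of \<open>M\<close> over \<open>B\<close>. For the reflected
  representation, where \<open>a\<close> is a source, they are the \<open>source_spaces\<close>.\<close>

definition sink_spaces :: "(nat \<Rightarrow> 'i \<Rightarrow> 'v set) \<Rightarrow> nat \<Rightarrow> 'v set set" where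
  "sink_spaces B l = S.subspaces_between (incoming_image (B l)) (vsp M a) (nat (d l a))"

definition source_spaces :: "(nat \<Rightarrow> 'i \<Rightarrow> 'v set) \<Rightarrow> nat \<Rightarrow> ('v \<times> ('e \<Rightarrow> 'v)) set set" where
  "source_spaces B l = R.subspaces_between {0} (incoming_kernel (B l)) (nat (refl_d l a))"

lemma finite_flag_base:
  assumes "finite (UNIV :: 'k set)"
  shows "finite flag_base"
proof (rule finite_subset)
  show "flag_base \<subseteq> {..\<nu>} \<rightarrow>\<^sub>E (\<Pi>\<^sub>E i\<in>verts Q - {a}. Pow (vsp M i))"
  proof
    fix B assume B: "B \<in> flag_base"
    then have "B \<in> {..\<nu>} \<rightarrow>\<^sub>E ((verts Q - {a}) \<rightarrow>\<^sub>E UNIV)" by (simp add: flag_base_def)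
    moreover have "B l i \<subseteq> vsp M i" if "l \<le> \<nu>" "i \<in> verts Q - {a}" for l i
      using B that by (simp add: flag_base_def subspace_family_def)
    ultimately show "B \<in> {..\<nu>} \<rightarrow>\<^sub>E (\<Pi>\<^sub>E i\<in>verts Q - {a}. Pow (vsp M i))"
      by (simp add: PiE_iff)
  qed
  have "finite (vsp M i)" if "i \<in> verts Q" for i
    using S.finite_card_fin_dim(1)[OF assms vsp_fin_dim[OF that]] .
  then show "finite ({..\<nu>} \<rightarrow>\<^sub>E (\<Pi>\<^sub>E i\<in>verts Q - {a}. Pow (vsp M i)))"
    using finite_verts by (intro finite_PiE) auto
qed

context
  fixes B assumes B: "B \<in> flag_base"
begin

lemma family: "l \<le> \<nu> \<Longrightarrow> subspace_family (B l)"
  using B by (simp add: flag_base_def)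

lemma B_mono:
  assumes "l < \<nu>"
  shows "incoming_image (B l) \<subseteq> incoming_image (B (Suc l))"
    and "incoming_kernel (B l) \<subseteq> incoming_kernel (B (Suc l))"
  using incoming_mono[of "B l" "B (Suc l)"] assms B by (auto simp: flag_base_def)

lemma B_top: "incoming_kernel (B \<nu>) = incoming_kernel (vsp M)"
proof -
  have "B \<nu> i = vsp M i" if "i \<in> verts Q - {a}" for i using B that by (simp add: flag_base_def)
  then show ?thesis by (intro equalityI incoming_mono(3)) auto
qed

lemma dim_image_kernel:
  assumes "l \<le> \<nu>"
  shows "int (S.dim (incoming_image (B l))) + int (R.dim (incoming_kernel (B l))) = excess l + d l a"
proof -
  have "(\<Sum>\<alpha>\<in>in_arcs Q a. int (S.dim (B l (tail Q \<alpha>)))) = (\<Sum>\<alpha>\<in>in_arcs Q a. d l (tail Q \<alpha>))"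
    using B assms tail_in_verts tail_neq_sink by (intro sum.cong) (auto simp: flag_base_def)
  then show ?thesis
    using arg_cong[OF incoming_dims(3)[OF family[OF assms]], of int] by (simp add: excess_def)
qed

text \<open>By \<open>dim_image_kernel\<close> the bound on the left for \<open>l\<close> says that \<open>excess l\<close> is at most the dimension of
  the \<open>l\<close>-th kernel. These dimensions increase with \<open>l\<close>, so the bounds can be replaced by those for
  the running maxima of \<open>excess\<close>. At \<open>l = \<nu>\<close> both bounds always hold.\<close>

lemma dim_bounds_equiv:
  "(\<forall>l\<le>\<nu>. int (S.dim (incoming_image (B l))) \<le> d l a) \<longleftrightarrow>
   (\<forall>l\<le>\<nu>. refl_d l a \<le> int (R.dim (incoming_kernel (B l))))" (is "?L \<longleftrightarrow> ?R")
proof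
  assume L: ?L
  have "refl_d l a \<le> int (R.dim (incoming_kernel (B l)))" if "l < \<nu>" for l
    using that
  proof (induction l)
    case (Suc l)
    have "R.dim (incoming_kernel (B l)) \<le> R.dim (incoming_kernel (B (Suc l)))"
      using Suc.prems incoming_dims(2)[OF family]
      by (intro R.fin_dim_dim_mono B_mono R.fin_dim_subspace) auto
    moreover have "int (S.dim (incoming_image (B (Suc l)))) \<le> d (Suc l) a"
      using L Suc.prems by simp
    ultimately show ?case
      using Suc dim_image_kernel[of "Suc l"] refl_d_sink_Suc[OF Suc.prems] by simp
  qed (simp add: refl_d_0)
  then show ?R using refl_d_top B_top by (metis le_neq_implies_less order_refl)
next
  assume R: ?R
  show ?L
  proof (intro allI impI)
    fix l assume l: "l \<le> \<nu>"
    consider "l = \<nu>" | "l = 0" "0 < \<nu>" | l' where "l = Suc l'" "l < \<nu>"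
      using l by (cases l) (auto simp: le_less)
    then show "int (S.dim (incoming_image (B l))) \<le> d l a"
    proof cases
      case 1
      have "S.dim (incoming_image (B l)) \<le> S.dim (vsp M a)"
        using incoming_dims(1,4)[OF family[OF l]] vsp_fin_dim[OF a_in_verts]
        by (intro S.fin_dim_dim_mono)
      then show ?thesis using 1 dimM[OF a_in_verts] by (simp add: dim_vector_def)
    next
      case 2
      then show ?thesis using dim_image_kernel[of 0] excess_0 by simp
    next
      case 3
      then have "excess l \<le> refl_d l a" using refl_d_sink_Suc by simp
      moreover have "refl_d l a \<le> int (R.dim (incoming_kernel (B l)))" using R l by blast
      ultimately show ?thesis using dim_image_kernel[OF l] by linarith
    qed
  qed
qed

lemma sink_chains_bounds:
  assumes "A \<in> chains (\<subseteq>) \<nu> (sink_spaces B)" "l \<le> \<nu>"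
  shows "int (S.dim (incoming_image (B l))) \<le> d l a"
proof -
  have A: "A l \<in> sink_spaces B l" using assms by (simp add: chains_iff)
  then have "S.fin_dim (A l)"
    using S.fin_dim_subset[OF vsp_fin_dim[OF a_in_verts]]
    by (auto simp: sink_spaces_def S.subspaces_between_def)
  then have "S.dim (incoming_image (B l)) \<le> nat (d l a)"
    using A S.fin_dim_dim_mono[of "A l"] incoming_dims(1)[OF family[OF assms(2)]]
    by (auto simp: sink_spaces_def S.subspaces_between_def)
  then show ?thesis using d_nonneg[OF assms(2) a_in_verts] by simp
qed

lemma source_chains_bounds:
  assumes "A \<in> chains (\<subseteq>) \<nu> (source_spaces B)" "l \<le> \<nu>"
  shows "refl_d l a \<le> int (R.dim (incoming_kernel (B l)))"
proof -
  have "A l \<in> source_spaces B l" using assms by (simp add: chains_iff)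
  then have "nat (refl_d l a) \<le> R.dim (incoming_kernel (B l))"
    using R.fin_dim_dim_mono[OF incoming_dims(2)[OF family[OF assms(2)]], of "A l"]
    by (auto simp: source_spaces_def R.subspaces_between_def)
  then show ?thesis by simp
qed

text \<open>The chain is chosen from the top: below a member \<open>Y\<close>, which contains the image of level \<open>l + 1\<close>
  and hence that of level \<open>l\<close>, the next member only has to lie between the latter and \<open>Y\<close>.\<close>

lemma one_modulo_sink_chains:
  assumes "\<And>l. l \<le> \<nu> \<Longrightarrow> int (S.dim (incoming_image (B l))) \<le> d l a"
  shows "one_modulo CARD('k) (chains (\<subseteq>) \<nu> (sink_spaces B))"
proof (rule one_modulo_chains_down)
  have le: "S.dim (incoming_image (B l)) \<le> nat (d l a)" if "l \<le> \<nu>" for l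
    using assms[OF that] by simp
  show "one_modulo CARD('k) (sink_spaces B \<nu>)"
    unfolding sink_spaces_def
    using incoming_dims[OF family] vsp_fin_dim[OF a_in_verts] le[of \<nu>] dimM[OF a_in_verts]
    by (intro S.one_modulo_subspaces_between) (auto simp: dim_vector_def)
  fix l Y assume l: "l < \<nu>" and Y: "Y \<in> sink_spaces B (Suc l)"
  have sub: "S.subspace Y" "incoming_image (B (Suc l)) \<subseteq> Y" "Y \<subseteq> vsp M a" "S.dim Y = nat (d (Suc l) a)"
    using Y by (auto simp: sink_spaces_def S.subspaces_between_def)
  have fd: "S.fin_dim Y" using sub S.fin_dim_subset[OF vsp_fin_dim[OF a_in_verts]] by blast
  have "{X \<in> sink_spaces B l. X \<subseteq> Y} = S.subspaces_between (incoming_image (B l)) Y (nat (d l a))"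
    using sub by (auto simp: sink_spaces_def S.subspaces_between_def)
  moreover have "one_modulo CARD('k) \<dots>"
    using fd incoming_dims(1)[OF family, of l] B_mono(1)[OF l] sub(2,4) le[of l] l d_mono[OF l a_in_verts]
    by (intro S.one_modulo_subspaces_between) auto
  ultimately show "one_modulo CARD('k) {X \<in> sink_spaces B l. X \<subseteq> Y}" by simp
qed

text \<open>Here the chain is chosen from the bottom, because now the upper bounds vary with the level and the
  lower bound is always 0.\<close>

lemma one_modulo_source_chains:
  assumes "\<And>l. l \<le> \<nu> \<Longrightarrow> refl_d l a \<le> int (R.dim (incoming_kernel (B l)))"
  shows "one_modulo CARD('k) (chains (\<subseteq>) \<nu> (source_spaces B))"
proof (rule one_modulo_chains_up)
  have le: "nat (refl_d l a) \<le> R.dim (incoming_kernel (B l))" if "l \<le> \<nu>" for l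
    using assms[OF that] by simp
  have mono: "nat (refl_d l a) \<le> nat (refl_d (Suc l) a)" if "l < \<nu>" for l
  proof (cases "Suc l < \<nu>")
    case True
    then show ?thesis using refl_d_sink_Suc by simp
  next
    case False
    then have "Suc l = \<nu>" using that by simp
    moreover have "R.dim (incoming_kernel (B l)) \<le> R.dim (incoming_kernel (B (Suc l)))"
      using that incoming_dims(2)[OF family]
      by (intro R.fin_dim_dim_mono B_mono R.fin_dim_subspace) auto
    ultimately show ?thesis using le[of l] that refl_d_top B_top by simp
  qed
  have dim0: "R.dim {0} = 0" using R.dim_span_eq_card_independent[OF R.independent_empty] by simp
  have K0: "{0} \<subseteq> incoming_kernel (B l)" if "l \<le> \<nu>" for l
    using R.subspace_0[OF R.fin_dim_subspace[OF incoming_dims(2)[OF family[OF that]]]] by simp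
  show "one_modulo CARD('k) (source_spaces B 0)"
    unfolding source_spaces_def
    using incoming_dims(2)[OF family] le K0[of 0] dim0
    by (intro R.one_modulo_subspaces_between) auto
  fix l X assume l: "l < \<nu>" and X: "X \<in> source_spaces B l"
  have sub: "R.subspace X" "X \<subseteq> incoming_kernel (B l)" "R.dim X = nat (refl_d l a)"
    using X by (auto simp: source_spaces_def R.subspaces_between_def)
  have "{Y \<in> source_spaces B (Suc l). X \<subseteq> Y} =
      R.subspaces_between X (incoming_kernel (B (Suc l))) (nat (refl_d (Suc l) a))"
    using R.subspace_0 by (auto simp: source_spaces_def R.subspaces_between_def)
  moreover have "one_modulo CARD('k) \<dots>"
    using sub incoming_dims(2)[OF family] B_mono(2)[OF l] le[of "Suc l"] l mono[OF l]
    by (intro R.one_modulo_subspaces_between) auto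
  ultimately show "one_modulo CARD('k) {Y \<in> source_spaces B (Suc l). X \<subseteq> Y}" by simp
qed

lemma fibre_dichotomy:
  "chains (\<subseteq>) \<nu> (sink_spaces B) = {} \<and> chains (\<subseteq>) \<nu> (source_spaces B) = {} \<or>
   one_modulo CARD('k) (chains (\<subseteq>) \<nu> (sink_spaces B)) \<and>
   one_modulo CARD('k) (chains (\<subseteq>) \<nu> (source_spaces B))"
proof (cases "\<forall>l\<le>\<nu>. int (S.dim (incoming_image (B l))) \<le> d l a")
  case True
  then show ?thesis
    using dim_bounds_equiv one_modulo_sink_chains one_modulo_source_chains by blast
next
  case False
  then show ?thesis
    using dim_bounds_equiv sink_chains_bounds source_chains_bounds by blast
qed

end

end

section \<open>Flags as pairs of a flag off the sink and a chain at the sink\<close>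

text \<open>The flag with components \<open>A\<close> at \<open>a\<close> and \<open>B\<close> elsewhere. The map \<open>emb\<close> embeds the components of \<open>B\<close>
  into the ambient space, which the reflection changes.\<close>

definition glue :: "nat \<Rightarrow> 'i set \<Rightarrow> 'i \<Rightarrow> ('x \<Rightarrow> 'y) \<Rightarrow> (nat \<Rightarrow> 'i \<Rightarrow> 'x) \<Rightarrow> (nat \<Rightarrow> 'y) \<Rightarrow> nat \<Rightarrow> 'i \<Rightarrow> 'y" where
  "glue n V a emb B A = (\<lambda>l\<in>{..n}. \<lambda>i\<in>V. if i = a then A l else emb (B l i))"

lemma bij_betw_glue:
  assumes "a \<in> V" "\<And>x. \<pi> (emb x) = x"
    and X: "X \<subseteq> {..n} \<rightarrow>\<^sub>E (V \<rightarrow>\<^sub>E UNIV)"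
    and base: "base \<subseteq> {..n} \<rightarrow>\<^sub>E ((V - {a}) \<rightarrow>\<^sub>E UNIV)"
    and C: "\<And>B. C B \<subseteq> {..n} \<rightarrow>\<^sub>E UNIV"
    and emb: "\<And>U l i. U \<in> X \<Longrightarrow> l \<le> n \<Longrightarrow> i \<in> V - {a} \<Longrightarrow> emb (\<pi> (U l i)) = U l i"
    and mem: "\<And>B A. B \<in> {..n} \<rightarrow>\<^sub>E ((V - {a}) \<rightarrow>\<^sub>E UNIV) \<Longrightarrow> A \<in> {..n} \<rightarrow>\<^sub>E UNIV \<Longrightarrow>
      glue n V a emb B A \<in> X \<longleftrightarrow> B \<in> base \<and> A \<in> C B"
  shows "bij_betw (\<lambda>(B, A). glue n V a emb B A) (Sigma base C) X"
proof -
  let ?F = "\<lambda>U. (\<lambda>l\<in>{..n}. \<lambda>i\<in>V - {a}. \<pi> (U l i), \<lambda>l\<in>{..n}. U l a)"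
  have FU: "glue n V a emb (fst (?F U)) (snd (?F U)) = U" if U: "U \<in> X" for U
  proof (intro ext)
    fix l i
    have U': "U \<in> {..n} \<rightarrow>\<^sub>E (V \<rightarrow>\<^sub>E UNIV)" using U X by blast
    show "glue n V a emb (fst (?F U)) (snd (?F U)) l i = U l i"
    proof (cases "l \<le> n")
      case True
      then have "U l \<in> V \<rightarrow>\<^sub>E UNIV" using U' by auto
      then show ?thesis
        using True emb[OF U True, of i] by (auto simp: glue_def PiE_def extensional_def)
    next
      case False
      then have "U l = undefined" using U' by (auto simp: PiE_def extensional_def)
      then show ?thesis using False by (simp add: glue_def)
    qed
  qed
  have Fmem: "?F U \<in> Sigma base C" if "U \<in> X" for U
  proof -
    have "fst (?F U) \<in> base \<and> snd (?F U) \<in> C (fst (?F U))"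
      using FU[OF that] that by (subst mem[symmetric]) auto
    then show ?thesis by simp
  qed
  have FG: "?F (glue n V a emb B A) = (B, A)" if "B \<in> base" "A \<in> C B" for B A
  proof -
    have B: "B \<in> {..n} \<rightarrow>\<^sub>E ((V - {a}) \<rightarrow>\<^sub>E UNIV)" using that base by blast
    have A: "A \<in> {..n} \<rightarrow>\<^sub>E UNIV" using that C by blast
    have "(\<lambda>l\<in>{..n}. \<lambda>i\<in>V - {a}. \<pi> (glue n V a emb B A l i)) l = B l" for l
    proof (cases "l \<le> n")
      case True
      then have "B l \<in> (V - {a}) \<rightarrow>\<^sub>E UNIV" using B by auto
      then show ?thesis using True assms(2)
        by (auto simp: glue_def fun_eq_iff PiE_def extensional_def)
    next
      case False
      then show ?thesis using B by (auto simp: PiE_def extensional_def)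
    qed
    moreover have "(\<lambda>l\<in>{..n}. glue n V a emb B A l a) l = A l" for l
      using A assms(1) by (auto simp: glue_def PiE_def extensional_def)
    ultimately show ?thesis by (auto simp: fun_eq_iff)
  qed
  show ?thesis
  proof (rule bij_betw_byWitness[where f' = ?F])
    show "\<forall>p\<in>Sigma base C. ?F ((\<lambda>(B, A). glue n V a emb B A) p) = p"
      using FG by (auto simp only: split_paired_all mem_Sigma_iff case_prod_conv)
    show "\<forall>U\<in>X. (\<lambda>(B, A). glue n V a emb B A) (?F U) = U"
      using FU by simp
    show "(\<lambda>(B, A). glue n V a emb B A) ` Sigma base C \<subseteq> X"
    proof clarify
      fix B A assume "B \<in> base" "A \<in> C B"
      then show "glue n V a emb B A \<in> X" using mem[of B A] base C[of B] by blast
    qed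
    show "?F ` X \<subseteq> Sigma base C" using Fmem by blast
  qed
qed

text \<open>A rearrangement common to the two descriptions of flags below: the conditions on the level \<open>l\<close>
  of a flag are separated into those on its part off \<open>a\<close> and those on its component at \<open>a\<close>. The top
  component at \<open>a\<close> is determined by its dimension, which is how the second assumption arises.\<close>

lemma regroup_level_conditions:
  fixes n :: nat
  assumes "\<And>l. l \<le> n \<Longrightarrow> X l \<and> Y l \<and> Z l \<longleftrightarrow> N l \<and> S l"
    and "W \<Longrightarrow> S n \<Longrightarrow> T"
  shows "(\<forall>l\<le>n. X l) \<and> (\<forall>l<n. P l \<and> P' l) \<and> (T \<and> W) \<and> (\<forall>l\<le>n. Y l \<and> Z l) \<longleftrightarrow>
    ((\<forall>l\<le>n. N l) \<and> (\<forall>l<n. P' l) \<and> W) \<and> (\<forall>l\<le>n. S l) \<and> (\<forall>l<n. P l)"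
proof -
  have "(\<forall>l\<le>n. X l) \<and> (\<forall>l\<le>n. Y l \<and> Z l) \<longleftrightarrow> (\<forall>l\<le>n. N l) \<and> (\<forall>l\<le>n. S l)"
    using assms(1) by blast
  moreover have "W \<Longrightarrow> \<forall>l\<le>n. S l \<Longrightarrow> T" using assms(2) by simp
  ultimately show ?thesis by blast
qed

context filtration_reflection
begin

lemma flags_bij:
  "bij_betw (\<lambda>(B, A). glue \<nu> (verts Q) a (\<lambda>W. W) B A)
     (SIGMA B:flag_base. chains (\<subseteq>) \<nu> (sink_spaces B)) (Fl Q \<nu> d M)"
proof (rule bij_betw_glue[where \<pi> = "\<lambda>W. W"])
  fix B :: "nat \<Rightarrow> 'i \<Rightarrow> 'v set" and A :: "nat \<Rightarrow> 'v set"
  assume ext: "B \<in> {..\<nu>} \<rightarrow>\<^sub>E ((verts Q - {a}) \<rightarrow>\<^sub>E UNIV)" "A \<in> {..\<nu>} \<rightarrow>\<^sub>E UNIV"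
  let ?G = "glue \<nu> (verts Q) a (\<lambda>W. W) B A"
  let ?N = "\<lambda>l. subspace_family (B l) \<and>
    (\<forall>\<alpha>\<in>arcs Q - in_arcs Q a. vmap M \<alpha> ` B l (tail Q \<alpha>) \<subseteq> B l (head Q \<alpha>)) \<and>
    (\<forall>i\<in>verts Q - {a}. int (S.dim (B l i)) = d l i)"
  have Gl: "?G l = (\<lambda>i\<in>verts Q. if i = a then A l else B l i)" if "l \<le> \<nu>" for l
    using that by (simp add: glue_def)
  have Ga: "?G l a = A l" if "l \<le> \<nu>" for l using that a_in_verts by (simp add: Gl)
  have Gi: "?G l i = B l i" if "l \<le> \<nu>" "i \<in> verts Q - {a}" for l i using that by (simp add: Gl)
  have verts: "(\<forall>i\<in>verts Q. P i) \<longleftrightarrow> P a \<and> (\<forall>i\<in>verts Q - {a}. P i)" for P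
    using a_in_verts by auto
  have level: "subrep Q M (?G l) \<and> int (S.dim (A l)) = d l a \<and>
      (\<forall>i\<in>verts Q - {a}. int (S.dim (B l i)) = d l i) \<longleftrightarrow> ?N l \<and> A l \<in> sink_spaces B l"
    if "l \<le> \<nu>" for l
  proof -
    have "A l \<in> sink_spaces B l \<longleftrightarrow>
        S.subspace (A l) \<and> incoming_image (B l) \<subseteq> A l \<and> A l \<subseteq> vsp M a \<and> int (S.dim (A l)) = d l a"
      using d_nonneg[OF that a_in_verts] by (auto simp: sink_spaces_def S.subspaces_between_def)
    then show ?thesis unfolding Gl[OF that] subrep_glue by blast
  qed
  have top: "A \<nu> = vsp M a" if "A \<nu> \<in> sink_spaces B \<nu>"
    using that dimM[OF a_in_verts] vsp_fin_dim[OF a_in_verts] S.fin_dim_eqI[of "vsp M a" "A \<nu>"]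
    by (auto simp: sink_spaces_def S.subspaces_between_def dim_vector_def)
  have "?G \<in> {..\<nu>} \<rightarrow>\<^sub>E (verts Q \<rightarrow>\<^sub>E UNIV)" by (auto simp: glue_def)
  then have "?G \<in> Fl Q \<nu> d M \<longleftrightarrow>
      (\<forall>l\<le>\<nu>. subrep Q M (?G l)) \<and>
      (\<forall>l<\<nu>. A l \<subseteq> A (Suc l) \<and> (\<forall>i\<in>verts Q - {a}. B l i \<subseteq> B (Suc l) i)) \<and>
      (A \<nu> = vsp M a \<and> (\<forall>i\<in>verts Q - {a}. B \<nu> i = vsp M i)) \<and>
      (\<forall>l\<le>\<nu>. int (S.dim (A l)) = d l a \<and> (\<forall>i\<in>verts Q - {a}. int (S.dim (B l i)) = d l i))"
    unfolding Fl_def verts by (simp add: Ga Gi)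
  also have "\<dots> \<longleftrightarrow> ((\<forall>l\<le>\<nu>. ?N l) \<and>
      (\<forall>l<\<nu>. \<forall>i\<in>verts Q - {a}. B l i \<subseteq> B (Suc l) i) \<and> (\<forall>i\<in>verts Q - {a}. B \<nu> i = vsp M i)) \<and>
      (\<forall>l\<le>\<nu>. A l \<in> sink_spaces B l) \<and> (\<forall>l<\<nu>. A l \<subseteq> A (Suc l))"
    by (rule regroup_level_conditions[OF level], assumption) (rule top)
  also have "\<dots> \<longleftrightarrow> B \<in> flag_base \<and> A \<in> chains (\<subseteq>) \<nu> (sink_spaces B)"
    using ext by (simp add: flag_base_def chains_def PiE_iff Ball_def)
  finally show "?G \<in> Fl Q \<nu> d M \<longleftrightarrow> B \<in> flag_base \<and> A \<in> chains (\<subseteq>) \<nu> (sink_spaces B)" .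
next
  show "Fl Q \<nu> d M \<subseteq> {..\<nu>} \<rightarrow>\<^sub>E (verts Q \<rightarrow>\<^sub>E UNIV)" by (auto simp only: Fl_def)
  show "flag_base \<subseteq> {..\<nu>} \<rightarrow>\<^sub>E ((verts Q - {a}) \<rightarrow>\<^sub>E UNIV)" by (auto simp only: flag_base_def)
qed (simp_all add: a_in_verts chains_subset_PiE)

text \<open>The components of a reflected flag off \<open>a\<close> have the form \<open>W \<times> {0}\<close>, so the first projection
  recovers \<open>W\<close>.\<close>

lemma reflected_flags_bij:
  "bij_betw (\<lambda>(B, A). glue \<nu> (verts Q) a (\<lambda>W. W \<times> {0}) B A)
     (SIGMA B:flag_base. chains (\<subseteq>) \<nu> (source_spaces B))
     (Fl (reflect_quiver Q a) \<nu> refl_d (reflect_rep Q a M))"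
proof (rule bij_betw_glue[where \<pi> = "\<lambda>W. fst ` W"])
  let ?Q = "reflect_quiver Q a" and ?M = "reflect_rep Q a M"
  have vQ: "verts ?Q = verts Q" by (simp add: reflect_quiver_def)
  have vsp: "vsp ?M i = vsp M i \<times> {0}" if "i \<noteq> a" for i using that by (simp add: reflect_rep_def)
  have times: "X \<times> {0} \<subseteq> Y \<times> {0} \<longleftrightarrow> X \<subseteq> Y" "X \<times> {0} = Y \<times> {0} \<longleftrightarrow> X = Y"
    for X Y :: "'v set" by (auto simp: times_eq_iff)
  fix B :: "nat \<Rightarrow> 'i \<Rightarrow> 'v set" and A :: "nat \<Rightarrow> ('v \<times> ('e \<Rightarrow> 'v)) set"
  assume ext: "B \<in> {..\<nu>} \<rightarrow>\<^sub>E ((verts Q - {a}) \<rightarrow>\<^sub>E UNIV)" "A \<in> {..\<nu>} \<rightarrow>\<^sub>E UNIV"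
  let ?G = "glue \<nu> (verts Q) a (\<lambda>W. W \<times> {0}) B A"
  let ?N = "\<lambda>l. subspace_family (B l) \<and>
    (\<forall>\<alpha>\<in>arcs Q - in_arcs Q a. vmap M \<alpha> ` B l (tail Q \<alpha>) \<subseteq> B l (head Q \<alpha>)) \<and>
    (\<forall>i\<in>verts Q - {a}. int (S.dim (B l i)) = d l i)"
  have Gl: "?G l = (\<lambda>i\<in>verts Q. if i = a then A l else B l i \<times> {0})" if "l \<le> \<nu>" for l
    using that by (simp add: glue_def)
  have Ga: "?G l a = A l" if "l \<le> \<nu>" for l using that a_in_verts by (simp add: Gl)
  have Gi: "?G l i = B l i \<times> {0}" if "l \<le> \<nu>" "i \<in> verts Q - {a}" for l i using that by (simp add: Gl)
  have verts: "(\<forall>i\<in>verts Q. P i) \<longleftrightarrow> P a \<and> (\<forall>i\<in>verts Q - {a}. P i)" for P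
    using a_in_verts by auto
  have level: "subrep ?Q ?M (?G l) \<and> int (R.dim (A l)) = refl_d l a \<and>
      (\<forall>i\<in>verts Q - {a}. int (R.dim (B l i \<times> {0})) = refl_d l i) \<longleftrightarrow> ?N l \<and> A l \<in> source_spaces B l"
    if "l \<le> \<nu>" for l
  proof -
    have "A l \<in> source_spaces B l \<longleftrightarrow>
        R.subspace (A l) \<and> A l \<subseteq> incoming_kernel (B l) \<and> int (R.dim (A l)) = refl_d l a"
      using refl_d_nonneg[OF that] R.subspace_0[of "A l"]
      by (auto simp: source_spaces_def R.subspaces_between_def)
    moreover have "int (R.dim (B l i \<times> {0})) = refl_d l i \<longleftrightarrow> int (S.dim (B l i)) = d l i"
      if "i \<in> verts Q - {a}" "subspace_family (B l)" for i
    proof -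
      have "S.fin_dim (B l i)"
        using that S.fin_dim_subset[OF vsp_fin_dim, of i "B l i"] by (simp add: subspace_family_def)
      then show ?thesis using that \<open>l \<le> \<nu>\<close> dim_times_zero refl_d_off_sink by simp
    qed
    ultimately show ?thesis unfolding Gl[OF that] subrep_reflect_glue by blast
  qed
  have top: "A \<nu> = vsp ?M a"
    if "\<forall>i\<in>verts Q - {a}. B \<nu> i = vsp M i" "A \<nu> \<in> source_spaces B \<nu>"
  proof -
    have "incoming_kernel (B \<nu>) = incoming_kernel (vsp M)"
      using that(1) by (intro equalityI incoming_mono(3)) auto
    then have "R.subspace (A \<nu>)" "A \<nu> \<subseteq> incoming_kernel (vsp M)" "R.dim (A \<nu>) = nat (refl_d \<nu> a)"
      using that(2) by (auto simp: source_spaces_def R.subspaces_between_def)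
    then show ?thesis
      unfolding vsp_reflect_rep_sink
      by (intro R.fin_dim_eqI incoming_dims(2) subspace_family_vsp) (simp_all add: refl_d_top)
  qed
  have "?G \<in> {..\<nu>} \<rightarrow>\<^sub>E (verts Q \<rightarrow>\<^sub>E UNIV)" by (auto simp: glue_def)
  then have "?G \<in> Fl ?Q \<nu> refl_d ?M \<longleftrightarrow>
      (\<forall>l\<le>\<nu>. subrep ?Q ?M (?G l)) \<and>
      (\<forall>l<\<nu>. A l \<subseteq> A (Suc l) \<and> (\<forall>i\<in>verts Q - {a}. B l i \<subseteq> B (Suc l) i)) \<and>
      (A \<nu> = vsp ?M a \<and> (\<forall>i\<in>verts Q - {a}. B \<nu> i = vsp M i)) \<and>
      (\<forall>l\<le>\<nu>. int (R.dim (A l)) = refl_d l a \<and>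
         (\<forall>i\<in>verts Q - {a}. int (R.dim (B l i \<times> {0})) = refl_d l i))"
    unfolding Fl_def vQ verts by (simp add: Ga Gi vsp times)
  also have "\<dots> \<longleftrightarrow> ((\<forall>l\<le>\<nu>. ?N l) \<and>
      (\<forall>l<\<nu>. \<forall>i\<in>verts Q - {a}. B l i \<subseteq> B (Suc l) i) \<and> (\<forall>i\<in>verts Q - {a}. B \<nu> i = vsp M i)) \<and>
      (\<forall>l\<le>\<nu>. A l \<in> source_spaces B l) \<and> (\<forall>l<\<nu>. A l \<subseteq> A (Suc l))"
    by (rule regroup_level_conditions[OF level], assumption) (rule top)
  also have "\<dots> \<longleftrightarrow> B \<in> flag_base \<and> A \<in> chains (\<subseteq>) \<nu> (source_spaces B)"
    using ext by (simp add: flag_base_def chains_def PiE_iff Ball_def)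
  finally show "?G \<in> Fl ?Q \<nu> refl_d ?M \<longleftrightarrow> B \<in> flag_base \<and> A \<in> chains (\<subseteq>) \<nu> (source_spaces B)" .
next
  let ?Q = "reflect_quiver Q a" and ?M = "reflect_rep Q a M"
  fix V l i assume V: "V \<in> Fl ?Q \<nu> refl_d ?M" "l \<le> \<nu>" and i: "i \<in> verts Q - {a}"
  from V have "subrep ?Q ?M (V l)" by (simp add: Fl_def)
  then have "V l i \<subseteq> vsp ?M i" using i by (simp add: subrep_def reflect_quiver_def)
  also have "\<dots> = vsp M i \<times> {0}" using i by (simp add: reflect_rep_def)
  finally have "V l i \<subseteq> vsp M i \<times> {0}" .
  then show "fst ` V l i \<times> {0} = V l i" by force
next
  show "Fl (reflect_quiver Q a) \<nu> refl_d (reflect_rep Q a M) \<subseteq> {..\<nu>} \<rightarrow>\<^sub>E (verts Q \<rightarrow>\<^sub>E UNIV)"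
    by (auto simp only: Fl_def reflect_quiver_def pre_digraph.simps)
  show "flag_base \<subseteq> {..\<nu>} \<rightarrow>\<^sub>E ((verts Q - {a}) \<rightarrow>\<^sub>E UNIV)" by (auto simp only: flag_base_def)
qed (simp_all add: a_in_verts chains_subset_PiE)

end

theorem theorem6p5:
  fixes Q :: "('i, 'e) pre_digraph"
    and a :: 'i
    and \<nu> :: nat
    and d :: "nat \<Rightarrow> 'i \<Rightarrow> int"
    and M :: "('i, 'e, 'k::field, 'v::ab_group_add) quiver_rep"
    and s :: nat
  assumes "finite_acyclic_quiver Q"
    and "sink Q a"
    and "filtration Q \<nu> d"
    and "quiver_representation Q M"
    and "\<forall>i\<in>verts Q. dim_vector M i = d \<nu> i"
    and "hom_dim Q M (simple_rep a) = s"
  shows "(Fl Q \<nu> d M = {} \<longleftrightarrow>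
            Fl (reflect_quiver Q a) \<nu> (reflect_filtration Q a M \<nu> d) (reflect_rep Q a M) = {}) \<and>
         (finite (UNIV :: 'k set) \<longrightarrow>
            [card (Fl Q \<nu> d M) =
             card (Fl (reflect_quiver Q a) \<nu> (reflect_filtration Q a M \<nu> d) (reflect_rep Q a M))]
            (mod card (UNIV :: 'k set)))"
proof -
  interpret filtration_reflection Q a M \<nu> d
    using assms
    by (intro filtration_reflection.intro sink_reflection.intro filtration_reflection_axioms.intro)
      (auto simp: finite_acyclic_quiver_def)
  let ?L = "SIGMA B:flag_base. chains (\<subseteq>) \<nu> (sink_spaces B)"
  let ?R = "SIGMA B:flag_base. chains (\<subseteq>) \<nu> (source_spaces B)"
  have "?L = {} \<longleftrightarrow> ?R = {}"
    using fibre_dichotomy by (rule cong_card_Sigma(1))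
  moreover have "[card ?L = card ?R] (mod CARD('k))" if "finite (UNIV :: 'k set)"
    using fibre_dichotomy that finite_flag_base[OF that]
    by (intro cong_card_Sigma(2)) (auto simp: card_gt_0_iff)
  moreover have "Fl Q \<nu> d M = {} \<longleftrightarrow> ?L = {}" "card (Fl Q \<nu> d M) = card ?L"
    using flags_bij bij_betw_same_card[OF flags_bij] by (auto simp: bij_betw_def)
  moreover have "Fl (reflect_quiver Q a) \<nu> refl_d (reflect_rep Q a M) = {} \<longleftrightarrow> ?R = {}"
    "card (Fl (reflect_quiver Q a) \<nu> refl_d (reflect_rep Q a M)) = card ?R"
    using reflected_flags_bij bij_betw_same_card[OF reflected_flags_bij] by (auto simp: bij_betw_def)
  ultimately show ?thesis by simp
qed

end
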